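(* Let $\alpha \in (1,\infty)$. Then: (1) for every $\lambda \in (\tfrac12,1)$, $\dim_H W_\lambda(\alpha) \le \tfrac{1}{\alpha}$; (2) for Lebesgue-almost every $\lambda \in (\tfrac12,\tfrac23)$, $W_\lambda(\alpha) \in \mathcal{G}^{s}(I_\lambda)$ with $s = \tfrac{1}{\alpha}$; (3) there is a dense set of $\lambda \in (\tfrac12,1)$ for which $\dim_H W_\lambda(\alpha) < \tfrac{1}{\alpha}$; (4) for every $\lambda \in (\tfrac12,1)$, $W_\lambda(\alpha) \in \mathcal{G}^{s}(I_\lambda)$ with $s = -\frac{\log\lambda}{\log 2}\cdot\frac{1}{\alpha}$; (5) there is a countable set of $\lambda \in (\tfrac12,1)$ for which $\dim_H W_\lambda(\alpha) = -\frac{\log\lambda}{\log 2}\cdot\frac{1}{\alpha}$.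
   Context: $\dim_H$ denotes Hausdorff dimension. For $\lambda \in (\tfrac12,1)$ let $I_\lambda = [0, \lambda/(1-\lambda)]$ and $$W_\lambda(\alpha) = \bigcap_{m\in\mathbb{N}}\bigcup_{n\ge m}\bigcup_{\omega\in\{0,1\}^n}\Big\{x\in I_\lambda : \Big|x-\sum_{i=1}^n \omega_i\lambda^i\Big| < 2^{-n\alpha}\Big\}.$$ For $s \ge 0$, Falconer's class $\mathcal{G}^s$ is the set of all $G_\delta$ sets $A \subseteq \mathbb{R}$ such that for every countable collection $\{f_j\}_{j\in\mathbb{N}}$ of similarity transformations $f_j:\mathbb{R}\to\mathbb{R}$ one has $\dim_H\big(\bigcap_{j} f_j(A)\big) \ge s$. For an interval $I$, $\mathcal{G}^s(I) = \{A \subseteq I : A + \operatorname{diam}(I)\cdot\mathbb{Z} \in \mathcal{G}^s\}$. *)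

theory Defs
  imports "HOL-Analysis.Analysis"
begin

text \<open>
  Hausdorff measure. The gauge of a covering set is its diameter to the power \<open>s\<close>, where
  the empty set has gauge \<open>0\<close> and, in contrast to the convention \<open>0 powr 0 = 0\<close>, a singleton
  has gauge \<open>1\<close> for \<open>s = 0\<close>. Boundedness of the covering sets is required explicitly because
  \<^const>\<open>diameter\<close> is only meaningful for bounded sets.
\<close>

definition hausdorff_gauge :: "real \<Rightarrow> 'a::metric_space set \<Rightarrow> ennreal" where
  "hausdorff_gauge s U =
     (if U = {} then 0 else if s = 0 then 1 else ennreal (diameter U powr s))"

definition hausdorff_premeasure :: "real \<Rightarrow> real \<Rightarrow> 'a::metric_space set \<Rightarrow> ennreal" where
  "hausdorff_premeasure s \<delta> A =
     (INF U \<in> {U :: nat \<Rightarrow> 'a set. A \<subseteq> (\<Union>i. U i) \<and> (\<forall>i. bounded (U i) \<and> diameter (U i) \<le> \<delta>)}.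
        \<Sum>i. hausdorff_gauge s (U i))"

definition hausdorff_measure :: "real \<Rightarrow> 'a::metric_space set \<Rightarrow> ennreal" where
  "hausdorff_measure s A = (SUP \<delta> \<in> {0<..}. hausdorff_premeasure s \<delta> A)"

definition hausdorff_dim :: "'a::metric_space set \<Rightarrow> ennreal" where
  "hausdorff_dim A = Inf {ennreal s | s. 0 \<le> s \<and> hausdorff_measure s A = 0}"

definition similarity :: "('a::metric_space \<Rightarrow> 'b::metric_space) \<Rightarrow> bool" where
  "similarity f \<longleftrightarrow> (\<exists>c>0. \<forall>x y. dist (f x) (f y) = c * dist x y)"

text \<open>
  Falconer's classes of sets with large intersections. Finite nonempty collections of
  similarities are covered by sequences with repetitions.
\<close>

definition falconer_class :: "real \<Rightarrow> real set set" where
  "falconer_class s =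
     {A. gdelta A \<and>
         (\<forall>f :: nat \<Rightarrow> real \<Rightarrow> real. (\<forall>j. similarity (f j)) \<longrightarrow>
            hausdorff_dim (\<Inter>j. f j ` A) \<ge> ennreal s)}"

definition falconer_class_on :: "real \<Rightarrow> real set \<Rightarrow> real set set" where
  "falconer_class_on s I =
     {A. A \<subseteq> I \<and> {a + diameter I * of_int k | a (k::int). a \<in> A} \<in> falconer_class s}"

definition I_interval :: "real \<Rightarrow> real set" where
  "I_interval l = {0 .. l / (1 - l)}"

definition W_set :: "real \<Rightarrow> real \<Rightarrow> real set" where
  "W_set l \<alpha> =
     (\<Inter>m::nat. \<Union>n\<in>{m..}. \<Union>\<omega> \<in> {1..n} \<rightarrow>\<^sub>E {0, 1::real}.
        {x \<in> I_interval l. \<bar>x - (\<Sum>i=1..n. \<omega> i * l ^ i)\<bar> < 2 powr (- real n * \<alpha>)})"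

end

theory Submission
  imports Defs "HOL-Computational_Algebra.Polynomial"
begin

text \<open>
  Call an open set large at exponent \<open>t\<close> if every small interval of half-length \<open>h\<close> contains finitely
  many tiny intervals in the set, of a common radius \<open>\<rho>\<close>, such that an interval of length \<open>r \<ge> \<rho>\<close> meets
  at most a proportion \<open>C (r / h) powr t\<close> of them, and an interval of length \<open>\<rho>\<close> a proportion
  \<open>o(\<rho> powr t)\<close>. Given a cover of small \<open>t\<close>-cost, one can therefore always pass to one of the tiny
  intervals on which the cost of the cover, relative to \<open>\<rho> powr t\<close>, is as small as one likes: the big
  covering sets miss most of the tiny intervals and the small ones cost little on average. Iterating through
  a sequence of large open sets yields a point of their intersection that is not covered. Largeness is
  invariant under similarities, so this bounds the dimension of all the intersections in Falconer's class.

  By self-similarity it suffices that, for infinitely many \<open>n\<close>, many digit sums of length \<open>n\<close> are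
  well spread down to scale \<open>\<theta> ^ n\<close>. For \<open>\<theta> = l\<close> this always holds since digit sums are
  \<open>l ^ n\<close>-dense. For \<open>\<theta> = 1/2\<close> it holds for almost every \<open>l < 2/3\<close>: polynomials with coefficients
  \<open>-1, 0, 1\<close> and constant term \<open>1\<close> have no near-double zero in \<open>[1/2, 2/3]\<close>, so the expected
  energy of the digit sums is bounded, and Fatou's lemma applies. The upper bounds count distinct
  digit sums; exact overlaps (for a dense set of parameters) reduce this count exponentially, and for
  \<open>l + l\<^sup>2 + \<dots> + l ^ d = 1\<close> a carry rule reduces it to order \<open>l powr - n\<close>.
\<close>

section \<open>Hausdorff content of intersections of large open sets\<close>

text \<open>The points are counted with multiplicity. The radius \<open>2 * \<rho>\<close> in the
  last condition fits covering intervals of radius below \<open>\<rho>\<close>: if one meets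
  \<open>cball (x i) \<rho>\<close>, its centre lies within \<open>2 * \<rho>\<close> of
  \<open>x i\<close>.\<close>

definition spread_family ::
    "real \<Rightarrow> real \<Rightarrow> real set \<Rightarrow> real \<Rightarrow> real \<Rightarrow> real \<Rightarrow> nat \<Rightarrow> (nat \<Rightarrow> real) \<Rightarrow> real \<Rightarrow> bool" where
  "spread_family t C A a h \<epsilon> N x \<rho> \<longleftrightarrow>
     0 < N \<and> 0 < \<rho> \<and> \<rho> < \<epsilon> \<and> (\<forall>i<N. cball (x i) \<rho> \<subseteq> cball a h \<inter> A) \<and>
     (\<forall>y r. \<rho> \<le> r \<longrightarrow> real (card {i. i < N \<and> \<bar>x i - y\<bar> \<le> r}) \<le> C * (r / h) powr t * real N) \<and>
     (\<forall>y. real (card {i. i < N \<and> \<bar>x i - y\<bar> \<le> 2 * \<rho>}) \<le> \<epsilon> * \<rho> powr t * real N)"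

text \<open>\<open>C\<close> does not depend on \<open>a\<close>, \<open>h\<close> or
  \<open>\<epsilon>\<close>, so the cost that a cover may have on an interval before the next
  refinement is a fixed multiple of \<open>h powr t\<close>.\<close>

definition large_in :: "real \<Rightarrow> real set \<Rightarrow> bool" where
  "large_in t A \<longleftrightarrow> (\<exists>C>0. \<exists>\<delta>>0. \<forall>a h. 0 < h \<and> h \<le> \<delta> \<longrightarrow>
     (\<forall>\<epsilon>>0. \<exists>N x \<rho>. spread_family t C A a h \<epsilon> N x \<rho>))"

text \<open>The sum runs over the covering intervals \<open>cball (y i) (d i)\<close> that meet
  \<open>cball a h\<close>.\<close>

definition hit_cost :: "real \<Rightarrow> (nat \<Rightarrow> real) \<Rightarrow> (nat \<Rightarrow> real) \<Rightarrow> real \<Rightarrow> real \<Rightarrow> real" where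
  "hit_cost t y d a h = (\<Sum>i. if \<bar>a - y i\<bar> \<le> d i + h then d i powr t else 0)"

lemma cball_subset_real:
  fixes a b :: real
  assumes "cball b s \<subseteq> cball a r" "0 \<le> s"
  shows "\<bar>b - a\<bar> + s \<le> r"
  using assms cball_subset_cball_iff[of b s a r] by (auto simp: dist_real_def)

lemma summable_hits:
  fixes d :: "nat \<Rightarrow> real"
  assumes "summable (\<lambda>i. d i powr t)"
  shows "summable (\<lambda>i. if P i then d i powr t else 0)"
  by (rule summable_comparison_test'[OF assms, of 0]) auto

text \<open>Averaging over the centres \<open>x j\<close>. Covering intervals of radius at least
  \<open>\<rho>\<close> get weight 1, shorter ones their cost relative to
  \<open>\<kappa> * \<rho> powr t\<close>. The mean weight meeting a tiny interval is below 1, so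
  some tiny interval meets no large covering interval and only cheap small ones.\<close>

lemma shrink_step:
  fixes d :: "nat \<Rightarrow> real"
  assumes t: "0 < t" and d: "\<And>i. 0 < d i" and sum: "summable (\<lambda>i. d i powr t)"
    and h: "0 < h" and C: "0 < C"
    and large: "\<And>\<epsilon>. 0 < \<epsilon> \<Longrightarrow> \<exists>N x \<rho>. spread_family t C A a h \<epsilon> N x \<rho>"
    and cost: "hit_cost t y d a h < h powr t / (2 * C * 2 powr t)"
    and \<kappa>: "0 < \<kappa>" and \<epsilon>: "0 < \<epsilon>"
  shows "\<exists>b s. 0 < s \<and> s < \<epsilon> \<and> cball b s \<subseteq> cball a h \<inter> A \<and> hit_cost t y d b s < \<kappa> * s powr t"
proof -
  define e where "e i = (if \<bar>a - y i\<bar> \<le> d i + h then d i powr t else 0)" for i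
  define E where "E = (\<Sum>i. e i)"
  have e0: "0 \<le> e i" for i by (simp add: e_def)
  have sume: "summable e" unfolding e_def by (rule summable_hits[OF sum])
  have E: "0 \<le> E" "E < h powr t / (2 * C * 2 powr t)"
  proof -
    show "0 \<le> E" unfolding E_def by (rule suminf_nonneg[OF sume e0])
    have "E = hit_cost t y d a h" by (simp add: E_def e_def[abs_def] hit_cost_def)
    then show "E < h powr t / (2 * C * 2 powr t)" using cost by simp
  qed
  \<comment> \<open>This makes \<open>\<epsilon>' * E / \<kappa>\<close> smaller than 1/2; the
    summand 1 keeps the denominator positive when \<open>E = 0\<close>.\<close>
  define \<epsilon>' where "\<epsilon>' = min \<epsilon> (\<kappa> / (2 * E + 1))"
  have \<epsilon>': "0 < \<epsilon>'" "\<epsilon>' \<le> \<epsilon>" "\<epsilon>' \<le> \<kappa> / (2 * E + 1)" 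
  proof -
    have "0 < \<kappa> / (2 * E + 1)" using \<kappa> E(1) by (intro divide_pos_pos) auto
    then show "0 < \<epsilon>'" "\<epsilon>' \<le> \<epsilon>" "\<epsilon>' \<le> \<kappa> / (2 * E + 1)"
      using \<epsilon> unfolding \<epsilon>'_def by auto
  qed
  obtain N x \<rho> where fam: "spread_family t C A a h \<epsilon>' N x \<rho>" using large[OF \<epsilon>'(1)] by blast
  then have N: "0 < N" and \<rho>: "0 < \<rho>" "\<rho> < \<epsilon>'"
    and sub: "\<And>j. j < N \<Longrightarrow> cball (x j) \<rho> \<subseteq> cball a h \<inter> A"
    and big: "\<And>y r. \<rho> \<le> r \<Longrightarrow> real (card {i. i < N \<and> \<bar>x i - y\<bar> \<le> r}) \<le> C * (r / h) powr t * real N"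
    and small: "\<And>y. real (card {i. i < N \<and> \<bar>x i - y\<bar> \<le> 2 * \<rho>}) \<le> \<epsilon>' * \<rho> powr t * real N"
    unfolding spread_family_def by blast+
  define g where "g i = (if \<rho> \<le> d i then (if e i = 0 then 0 else 1) else e i / (\<kappa> * \<rho> powr t))" for i
  define H where "H j i \<longleftrightarrow> \<bar>x j - y i\<bar> \<le> d i + \<rho>" for j i
  have \<rho>t: "0 < \<rho> powr t" using \<rho> by simp
  have g0: "0 \<le> g i" for i using e0[of i] \<kappa> \<rho>t by (auto simp: g_def)
  \<comment> \<open>A relevant radius \<open>d i \<ge> \<rho>\<close> has cost at least
    \<open>\<rho> powr t\<close>, so the weights are dominated by a multiple of
    \<open>e\<close>.\<close>
  have "g i \<le> e i * (1 / \<rho> powr t + 1 / (\<kappa> * \<rho> powr t))" for i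
  proof (cases "\<rho> \<le> d i \<and> e i \<noteq> 0")
    case True
    then have "e i = d i powr t" by (auto simp: e_def split: if_splits)
    then have "\<rho> powr t \<le> e i" using True \<rho> t by (auto intro!: powr_mono2)
    then have "1 \<le> e i * (1 / \<rho> powr t)" using \<rho>t by (simp add: field_simps)
    moreover have "0 \<le> e i * (1 / (\<kappa> * \<rho> powr t))" using e0[of i] \<kappa> by simp
    ultimately show ?thesis using True by (simp add: g_def distrib_left)
  next
    case False
    then show ?thesis using e0[of i] \<kappa> by (auto simp: g_def distrib_left)
  qed
  then have sumg: "summable (\<lambda>i. if H j i then g i else 0)" for j
    using g0 e0 \<kappa>
    by (intro summable_comparison_test'[OF summable_mult2[OF sume, of "1 / \<rho> powr t + 1 / (\<kappa> * \<rho> powr t)"], of 0])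
      auto
  \<comment> \<open>The two summands are the average contributions of the large and of the small
    covering intervals; \<open>cost\<close> and the choice of \<open>\<epsilon>'\<close> push each
    below 1/2 after multiplication by \<open>E\<close>.\<close>
  define K where "K = C * 2 powr t / h powr t + \<epsilon>' / \<kappa>"
  have K: "K * E < 1"
  proof -
    have 1: "C * 2 powr t / h powr t * E < 1/2"
      using E(2) C h by (simp add: field_simps)
    have "\<epsilon>' * E \<le> \<kappa> / (2 * E + 1) * E"
      using \<epsilon>' E by (intro mult_right_mono)
    moreover have "\<kappa> / (2 * E + 1) * E < \<kappa> / 2" using \<kappa> E by (simp add: field_simps)
    ultimately have "\<epsilon>' * E < \<kappa> / 2" by linarith
    then have "\<epsilon>' / \<kappa> * E < 1/2" using \<kappa> by (simp add: divide_less_eq mult.commute)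
    moreover have "K * E = C * 2 powr t / h powr t * E + \<epsilon>' / \<kappa> * E"
      unfolding K_def by (rule distrib_right)
    ultimately show ?thesis using 1 by linarith
  qed
  have avg: "(\<Sum>j<N. if H j i then g i else 0) \<le> K * real N * e i" for i
  proof -
    have "(\<Sum>j<N. if H j i then g i else 0) = real (card {j. j < N \<and> H j i}) * g i"
      by (simp add: sum.If_cases Int_def lessThan_def)
    also have "\<dots> \<le> K * real N * e i"
    proof (cases "\<rho> \<le> d i")
      case True
      then have ge: "g i \<le> e i / d i powr t" using \<open>0 < \<rho>\<close> by (auto simp: g_def e_def)
      \<comment> \<open>An interval of radius \<open>d i \<ge> \<rho>\<close> that meets
        \<open>cball (x j) \<rho>\<close> has its centre within \<open>2 * d i\<close> of
        \<open>x j\<close>; hence the factor \<open>2 powr t\<close>.\<close>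
      have "real (card {j. j < N \<and> H j i}) \<le> C * ((2 * d i) / h) powr t * real N"
      proof -
        have "card {j. j < N \<and> H j i} \<le> card {j. j < N \<and> \<bar>x j - y i\<bar> \<le> 2 * d i}"
          using True by (intro card_mono) (auto simp: H_def)
        also have "real \<dots> \<le> C * ((2 * d i) / h) powr t * real N" using True \<rho> by (intro big) auto
        finally show ?thesis by simp
      qed
      then have "real (card {j. j < N \<and> H j i}) * g i \<le> C * ((2 * d i) / h) powr t * real N * (e i / d i powr t)"
        using ge g0[of i] by (intro mult_mono) (use C in auto)
      also have "\<dots> = C * 2 powr t / h powr t * real N * e i"
        using d[of i] h by (simp add: powr_divide powr_mult)
      also have "\<dots> \<le> K * real N * e i"
        using \<epsilon>' \<kappa> e0[of i] by (intro mult_right_mono) (auto simp: K_def)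
      finally show ?thesis .
    next
      case False
      have "real (card {j. j < N \<and> H j i}) \<le> \<epsilon>' * \<rho> powr t * real N"
      proof -
        have "card {j. j < N \<and> H j i} \<le> card {j. j < N \<and> \<bar>x j - y i\<bar> \<le> 2 * \<rho>}"
          using False by (intro card_mono) (auto simp: H_def)
        also have "real \<dots> \<le> \<epsilon>' * \<rho> powr t * real N" by (rule small)
        finally show ?thesis by simp
      qed
      then have "real (card {j. j < N \<and> H j i}) * g i \<le> \<epsilon>' * \<rho> powr t * real N * (e i / (\<kappa> * \<rho> powr t))"
        using g0[of i] False \<epsilon>' by (intro mult_mono) (auto simp: g_def)
      also have "\<dots> = \<epsilon>' / \<kappa> * real N * e i" using \<rho>t \<kappa> by simp
      also have "\<dots> \<le> K * real N * e i"
        using C e0[of i] by (intro mult_right_mono) (auto simp: K_def)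
      finally show ?thesis .
    qed
    finally show ?thesis .
  qed
  have "\<exists>j<N. (\<Sum>i. if H j i then g i else 0) < 1"
  proof (rule ccontr)
    assume "\<not> ?thesis"
    then have "real N \<le> (\<Sum>j<N. \<Sum>i. if H j i then g i else 0)"
      using sum_mono[of "{..<N}" "\<lambda>_. 1::real" "\<lambda>j. \<Sum>i. if H j i then g i else 0"] by force
    also have "\<dots> = (\<Sum>i. \<Sum>j<N. if H j i then g i else 0)"
      by (rule suminf_sum[symmetric]) (rule sumg)
    also have "\<dots> \<le> (\<Sum>i. K * real N * e i)"
      by (intro suminf_le avg summable_sum sumg summable_mult sume)
    also have "\<dots> = K * E * real N" by (simp add: suminf_mult[OF sume] E_def)
    also have "\<dots> < real N" using K N by simp
    finally show False by simp
  qed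
  then obtain j where j: "j < N" "(\<Sum>i. if H j i then g i else 0) < 1" by blast
  have xj: "\<bar>x j - a\<bar> + \<rho> \<le> h" using cball_subset_real[of "x j" \<rho> a h] sub[OF j(1)] \<rho> by auto
  \<comment> \<open>What meets the tiny interval also meets \<open>cball a h\<close>, so its cost
    was counted in \<open>e\<close>.\<close>
  have He: "e i = d i powr t" if "H j i" for i
    using that xj \<open>0 < \<rho>\<close> unfolding H_def e_def by auto
  have small_d: "d i < \<rho>" if "H j i" for i
  proof (rule ccontr)
    assume "\<not> d i < \<rho>"
    then have "g i = 1" using He[OF that] d[of i] by (simp add: g_def)
    moreover have "(if H j i then g i else 0) \<le> (\<Sum>i. if H j i then g i else 0)"
      using sum_le_suminf[OF sumg, of "{i}" j] g0 by auto
    ultimately show False using j that by simp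
  qed
  have "(\<Sum>i. if H j i then g i else 0) = (\<Sum>i. (if H j i then d i powr t else 0) * (1 / (\<kappa> * \<rho> powr t)))"
  proof (rule suminf_cong)
    fix i
    show "(if H j i then g i else 0) = (if H j i then d i powr t else 0) * (1 / (\<kappa> * \<rho> powr t))"
      using small_d[of i] He[of i] by (auto simp: g_def)
  qed
  also have "\<dots> = hit_cost t y d (x j) \<rho> * (1 / (\<kappa> * \<rho> powr t))"
    unfolding hit_cost_def H_def by (intro suminf_mult2[symmetric] summable_hits[OF sum])
  finally have "hit_cost t y d (x j) \<rho> < \<kappa> * \<rho> powr t"
    using j(2) \<kappa> \<rho>t by (simp add: field_simps)
  moreover have "\<rho> < \<epsilon>" using \<rho> \<epsilon>' by simp
  ultimately show ?thesis using \<rho> sub[OF j(1)] by blast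
qed


section \<open>Positive content and Hausdorff dimension\<close>

definition positive_content :: "real \<Rightarrow> real set \<Rightarrow> bool" where
  "positive_content t E \<longleftrightarrow> (\<exists>c>0. \<forall>y d. (\<forall>i::nat. 0 < d i) \<longrightarrow> summable (\<lambda>i. d i powr t) \<longrightarrow>
     (\<Sum>i. d i powr t) < c \<longrightarrow> \<not> E \<subseteq> (\<Union>i. cball (y i) (d i)))"

lemma positive_content_mono:
  assumes "positive_content t E" "E \<subseteq> F"
  shows "positive_content t F"
  using assms unfolding positive_content_def by (meson order_trans)

text \<open>Iterating \<open>shrink_step\<close> gives nested compact intervals with radii tending
  to 0, the \<open>k\<close>-th refinement taking place inside \<open>A k\<close>. Their common
  point is not covered: a covering interval containing it would meet all of them, and its radius
  would be below each of theirs.\<close>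

lemma positive_content_Inter_large_in:
  assumes t: "0 < t" and large: "\<And>k::nat. large_in t (A k)" and \<eta>: "0 < \<eta>"
  shows "positive_content t (cball a \<eta> \<inter> (\<Inter>k. A k))"
proof -
  obtain C \<delta> where C: "\<And>k. 0 < C k" and \<delta>: "\<And>k. 0 < \<delta> k"
    and fam: "\<And>k a h \<epsilon>. 0 < h \<Longrightarrow> h \<le> \<delta> k \<Longrightarrow> 0 < \<epsilon> \<Longrightarrow> \<exists>N x \<rho>. spread_family t (C k) (A k) a h \<epsilon> N x \<rho>"
    using large unfolding large_in_def by metis
  \<comment> \<open>The bound with \<open>C k\<close> admits the next application of
    \<open>shrink_step\<close>; the bound 1 forces every covering interval that meets the current
    interval to be shorter than it.\<close>
  define \<kappa> where "\<kappa> k = min 1 (1 / (2 * C k * 2 powr t))" for k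
  define h0 where "h0 = min \<eta> (\<delta> 0)"
  have \<kappa>: "0 < \<kappa> k" "\<kappa> k \<le> 1" "\<kappa> k \<le> 1 / (2 * C k * 2 powr t)" for k
    using C[of k] by (auto simp: \<kappa>_def)
  have h0: "0 < h0" "h0 \<le> \<eta>" "h0 \<le> \<delta> 0" using \<eta> \<delta>[of 0] by (auto simp: h0_def)
  show ?thesis
    unfolding positive_content_def
  proof (intro exI[of _ "\<kappa> 0 * h0 powr t"] conjI allI impI notI)
    show "0 < \<kappa> 0 * h0 powr t" using \<kappa> h0 by simp
  next
    fix y d :: "nat \<Rightarrow> real"
    assume d0: "\<forall>i. 0 < d i" and sum: "summable (\<lambda>i. d i powr t)"
      and less: "(\<Sum>i. d i powr t) < \<kappa> 0 * h0 powr t"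
      and cov: "cball a \<eta> \<inter> (\<Inter>k. A k) \<subseteq> (\<Union>i. cball (y i) (d i))"
    define Inv where "Inv k p \<longleftrightarrow> 0 < snd p \<and> snd p \<le> \<delta> k \<and> snd p \<le> h0 / 2 ^ k \<and>
        hit_cost t y d (fst p) (snd p) < \<kappa> k * snd p powr t" for k and p :: "real \<times> real"
    define R where "R k p q \<longleftrightarrow> cball (fst q) (snd q) \<subseteq> cball (fst p) (snd p) \<inter> A k"
      for k and p q :: "real \<times> real"
    have start: "Inv 0 (a, h0)"
    proof -
      have "hit_cost t y d a h0 \<le> (\<Sum>i. d i powr t)"
        unfolding hit_cost_def by (intro suminf_le summable_hits sum) auto
      then show ?thesis using less h0 by (simp add: Inv_def)
    qed
    have step: "\<exists>q. Inv (Suc k) q \<and> R k p q" if inv: "Inv k p" for k p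
    proof -
      have "hit_cost t y d (fst p) (snd p) < snd p powr t / (2 * C k * 2 powr t)"
      proof -
        have "\<kappa> k * snd p powr t \<le> 1 / (2 * C k * 2 powr t) * snd p powr t"
          using \<kappa>(3) by (intro mult_right_mono) auto
        then show ?thesis using inv by (simp add: Inv_def)
      qed
      moreover have "0 < min (\<delta> (Suc k)) (h0 / 2 ^ Suc k)" using \<delta> h0 by simp
      ultimately obtain b s where "0 < s" "s < min (\<delta> (Suc k)) (h0 / 2 ^ Suc k)"
        "cball b s \<subseteq> cball (fst p) (snd p) \<inter> A k" "hit_cost t y d b s < \<kappa> (Suc k) * s powr t"
        using shrink_step[of t d "snd p" "C k" "A k" "fst p" y "\<kappa> (Suc k)" "min (\<delta> (Suc k)) (h0 / 2 ^ Suc k)"]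
          t d0 sum inv C[of k] fam[of "snd p" k] \<kappa>(1)[of "Suc k"] unfolding Inv_def by blast
      then show ?thesis by (intro exI[of _ "(b, s)"]) (auto simp: Inv_def R_def)
    qed
    have "\<exists>f. \<forall>k. (Inv k (f k) \<and> (k = 0 \<longrightarrow> f k = (a, h0))) \<and> R k (f k) (f (Suc k))"
    proof (rule dependent_nat_choice)
      show "\<exists>p. Inv 0 p \<and> (0 = (0::nat) \<longrightarrow> p = (a, h0))" using start by blast
      show "\<exists>q. (Inv (Suc k) q \<and> (Suc k = 0 \<longrightarrow> q = (a, h0))) \<and> R k p q"
        if "Inv k p \<and> (k = 0 \<longrightarrow> p = (a, h0))" for p k
        using step that by blast
    qed
    then obtain f where f: "f 0 = (a, h0)" "\<And>k. Inv k (f k)" "\<And>k. R k (f k) (f (Suc k))"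
      by blast
    define B where "B k = cball (fst (f k)) (snd (f k))" for k
    have sub: "B (Suc k) \<subseteq> B k \<inter> A k" for k using f(3)[of k] by (simp add: B_def R_def)
    have dec: "B n \<subseteq> B m" if "m \<le> n" for m n
      using that by (rule lift_Suc_antimono_le[rotated]) (use sub in auto)
    have "\<Inter>(range B) \<noteq> {}"
    proof (rule compact_nest)
      show "compact (B k)" "B k \<noteq> {}" for k using f(2)[of k] by (auto simp: B_def Inv_def)
    qed (rule dec)
    then obtain z where z: "\<And>k. z \<in> B k" by blast
    have "z \<in> cball a \<eta>" using z[of 0] f(1) h0 by (auto simp: B_def)
    moreover have "z \<in> A k" for k using z[of "Suc k"] sub[of k] by blast
    ultimately obtain i where i: "z \<in> cball (y i) (d i)" using cov by blast
    have "d i \<le> h0 / 2 ^ k" for k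
    proof -
      have inv: "0 < snd (f k)" "snd (f k) \<le> h0 / 2 ^ k"
        "hit_cost t y d (fst (f k)) (snd (f k)) < \<kappa> k * snd (f k) powr t"
        using f(2)[of k] by (auto simp: Inv_def)
      have "\<bar>fst (f k) - y i\<bar> \<le> d i + snd (f k)"
        using i z[of k] by (auto simp: B_def dist_real_def)
      then have "d i powr t = (\<Sum>j\<in>{i}. if \<bar>fst (f k) - y j\<bar> \<le> d j + snd (f k) then d j powr t else 0)"
        by simp
      also have "\<dots> \<le> hit_cost t y d (fst (f k)) (snd (f k))"
        unfolding hit_cost_def by (intro sum_le_suminf summable_hits[OF sum]) auto
      also have "\<dots> < \<kappa> k * snd (f k) powr t" by (rule inv)
      also have "\<dots> \<le> snd (f k) powr t" using \<kappa>[of k] by (simp add: mult_left_le_one_le)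
      finally have "d i < snd (f k)"
        using powr_mono2[of t "snd (f k)" "d i"] t inv by linarith
      then show ?thesis using inv by simp
    qed
    moreover have "(\<lambda>k. h0 / 2 ^ k) \<longlonglongrightarrow> 0" by (rule LIMSEQ_divide_realpow_zero) simp
    ultimately have "d i \<le> 0" by (intro LIMSEQ_le_const) auto
    then show False using d0 by (simp add: not_le[symmetric])
  qed
qed

text \<open>If the \<open>s'\<close>-dimensional measure vanishes for some \<open>s' < s\<close>,
  there are covers of arbitrarily small gauge. At a larger exponent \<open>t < s\<close>, sets of
  diameter at most 1 cost no more, which contradicts positive content.\<close>

lemma hausdorff_dim_ge:
  fixes E :: "real set"
  assumes content: "\<And>t. 0 < t \<Longrightarrow> t < s \<Longrightarrow> positive_content t E"
  shows "ennreal s \<le> hausdorff_dim E"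
  unfolding hausdorff_dim_def le_Inf_iff
proof safe
  fix s' :: real
  assume s': "0 \<le> s'" "hausdorff_measure s' E = 0"
  show "ennreal s \<le> ennreal s'"
  proof (rule ccontr)
    assume "\<not> ?thesis"
    then have "s' < s" using ennreal_leI[of s s'] by linarith
    \<comment> \<open>The midpoint is positive even for \<open>s' = 0\<close>, where the gauge of a
      nonempty set is 1.\<close>
    define t where "t = (s' + s) / 2"
    have t: "0 < t" "t < s" "s' < t" using \<open>s' < s\<close> s' by (auto simp: t_def)
    obtain c where c: "0 < c" and nc': "\<And>y d. (\<And>i. 0 < d i) \<Longrightarrow> summable (\<lambda>i. d i powr t) \<Longrightarrow>
        (\<Sum>i. d i powr t) < c \<Longrightarrow> \<not> E \<subseteq> (\<Union>i. cball (y i) (d i))"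
      using content[OF t(1,2)] unfolding positive_content_def by metis
    have "hausdorff_premeasure s' 1 E \<le> hausdorff_measure s' E"
      unfolding hausdorff_measure_def by (intro SUP_upper) auto
    then have "hausdorff_premeasure s' 1 E < ennreal (c / 2)"
      using s' c by simp
    then obtain U where U: "E \<subseteq> (\<Union>i. U i)" "\<And>i. bounded (U i)" "\<And>i. diameter (U i) \<le> 1"
      and less: "(\<Sum>i. hausdorff_gauge s' (U i)) < ennreal (c / 2)"
      unfolding hausdorff_premeasure_def INF_less_iff by auto
    define \<gamma> where "\<gamma> i = diameter (U i) powr t" for i
    have \<gamma>0: "0 \<le> \<gamma> i" for i by (simp add: \<gamma>_def)
    have "ennreal (\<gamma> i) \<le> hausdorff_gauge s' (U i)" for i
    proof (cases "U i = {}")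
      case False
      have D: "0 \<le> diameter (U i)" "diameter (U i) \<le> 1" using U diameter_ge_0 by auto
      have "\<gamma> i \<le> 1" using D t by (simp add: \<gamma>_def powr_le1)
      moreover have "\<gamma> i \<le> diameter (U i) powr s'" if "s' \<noteq> 0"
        using D t that s' by (cases "diameter (U i) = 0") (auto simp: \<gamma>_def intro!: powr_mono')
      ultimately show ?thesis using False by (auto simp: hausdorff_gauge_def ennreal_leI)
    qed (use t in \<open>simp add: \<gamma>_def\<close>)
    then have "(\<Sum>i. ennreal (\<gamma> i)) \<le> (\<Sum>i. hausdorff_gauge s' (U i))"
      by (intro suminf_le) auto
    then have lt: "(\<Sum>i. ennreal (\<gamma> i)) < ennreal (c / 2)" using less by (rule le_less_trans)
    then have sum\<gamma>: "summable \<gamma>" using \<gamma>0 by (intro summable_suminf_not_top) auto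
    have "ennreal (\<Sum>i. \<gamma> i) < ennreal (c / 2)"
      using lt unfolding suminf_ennreal2[OF \<gamma>0 sum\<gamma>] .
    then have lt': "(\<Sum>i. \<gamma> i) < c / 2" by (simp add: ennreal_less_iff suminf_nonneg[OF sum\<gamma>] \<gamma>0)
    \<comment> \<open>These positive summands, of total \<open>c / 2\<close>, turn diameters that
      may vanish into positive radii.\<close>
    define g where "g i = c / 4 * (1 / 2) ^ i" for i :: nat
    have g: "0 < g i" for i using c by (simp add: g_def)
    have gs: "g sums (c / 4 * 2)"
      unfolding g_def using sums_mult[OF geometric_sums[of "1/2::real"], of "c/4"] by simp
    define d where "d i = (\<gamma> i + g i) powr (1 / t)" for i
    have pos: "0 < \<gamma> i + g i" for i using \<gamma>0[of i] g[of i] by simp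
    have dt: "d i powr t = \<gamma> i + g i" for i
      using pos[of i] t by (simp add: d_def powr_powr)
    define y where "y i = (SOME z. z \<in> U i)" for i
    have sub: "U i \<subseteq> cball (y i) (d i)" for i
    proof
      fix z assume z: "z \<in> U i"
      then have "y i \<in> U i" unfolding y_def by (rule someI)
      then have "dist (y i) z \<le> diameter (U i)" using z U by (intro diameter_bounded_bound)
      also have "\<dots> = \<gamma> i powr (1 / t)" using t U diameter_ge_0[of "U i"] by (simp add: \<gamma>_def powr_powr)
      also have "\<dots> \<le> d i" unfolding d_def using t \<gamma>0 g[of i] by (intro powr_mono2) auto
      finally show "z \<in> cball (y i) (d i)" by simp
    qed
    have "E \<subseteq> (\<Union>i. cball (y i) (d i))"
      using U(1) by (rule order_trans) (intro UN_mono subset_refl sub)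
    moreover have "summable (\<lambda>i. d i powr t)"
      unfolding dt by (intro summable_add sum\<gamma> sums_summable[OF gs])
    moreover have "(\<Sum>i. d i powr t) < c"
    proof -
      have "suminf g = c / 2" using sums_unique[OF gs] by simp
      then show ?thesis unfolding dt using suminf_add[OF sum\<gamma> sums_summable[OF gs]] lt' by linarith
    qed
    moreover have "0 < d i" for i using pos[of i] by (simp add: d_def)
    ultimately show False using nc'[of d y] by simp
  qed
qed

section \<open>Digit sums and the upper bound\<close>

text \<open>The recursion puts a new digit in front. Words with equal sums give one element, so
  cardinalities reflect exact overlaps.\<close>

primrec digit_sums :: "real \<Rightarrow> nat \<Rightarrow> real set" where
  "digit_sums l 0 = {0}"
| "digit_sums l (Suc n) = (\<lambda>x. l * x) ` digit_sums l n \<union> (\<lambda>x. l * (1 + x)) ` digit_sums l n"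

lemma finite_digit_sums [simp]: "finite (digit_sums l n)"
  by (induction n) auto

lemma digit_sums_nonempty [simp]: "digit_sums l n \<noteq> {}"
  by (induction n) auto

lemma card_digit_sums_le: "card (digit_sums l n) \<le> 2 ^ n"
proof (induction n)
  case (Suc n)
  have "card (digit_sums l (Suc n)) \<le> card ((\<lambda>x. l * x) ` digit_sums l n) + card ((\<lambda>x. l * (1 + x)) ` digit_sums l n)"
    by (simp add: card_Un_le)
  also have "\<dots> \<le> card (digit_sums l n) + card (digit_sums l n)"
    by (intro add_mono card_image_le) auto
  finally show ?case using Suc by simp
qed simp

text \<open>Concatenation of words: the first \<open>k\<close> digits fix an offset, and the rest is
  a copy scaled by \<open>l ^ k\<close>.\<close>

lemma digit_sums_add:
  "digit_sums l (k + n) = (\<Union>s\<in>digit_sums l k. (\<lambda>s'. s + l ^ k * s') ` digit_sums l n)"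
proof (induction k)
  case (Suc k)
  have "(\<lambda>x. l * x) ` (\<Union>s\<in>A. (\<lambda>s'. s + l ^ k * s') ` B) =
      (\<Union>s\<in>(\<lambda>x. l * x) ` A. (\<lambda>s'. s + l ^ Suc k * s') ` B)" for A B
    by (simp add: image_UN image_image distrib_left mult.assoc)
  moreover have "(\<lambda>x. l * (1 + x)) ` (\<Union>s\<in>A. (\<lambda>s'. s + l ^ k * s') ` B) =
      (\<Union>s\<in>(\<lambda>x. l * (1 + x)) ` A. (\<lambda>s'. s + l ^ Suc k * s') ` B)" for A B
    by (simp add: image_UN image_image distrib_left mult.assoc add.assoc)
  ultimately show ?case
    by (simp only: add_Suc digit_sums.simps Suc.IH UN_Un)
qed simp

lemma digit_sums_Suc_last:
  "digit_sums l (Suc n) = digit_sums l n \<union> (\<lambda>s. s + l ^ Suc n) ` digit_sums l n"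
  using digit_sums_add[of l n 1] by (auto simp: algebra_simps)

text \<open>Both maps of the recursion preserve \<open>[0, l / (1 - l)]\<close>, whose right end is
  the fixed point of the second.\<close>

lemma digit_sums_bounds:
  assumes l: "0 < l" "l < 1" and "s \<in> digit_sums l n"
  shows "0 \<le> s" "s \<le> l / (1 - l)"
proof -
  have L: "l * (1 + l / (1 - l)) = l / (1 - l)" "0 \<le> l / (1 - l)" using l by (auto simp: field_simps)
  have "0 \<le> s \<and> s \<le> l / (1 - l)"
    using assms(3)
  proof (induction n arbitrary: s)
    case 0
    then show ?case using L(2) by simp
  next
    case (Suc n)
    have "\<exists>x a. x \<in> digit_sums l n \<and> s = l * (a + x) \<and> (a = 0 \<or> a = 1)"
    proof (cases "s \<in> (\<lambda>x. l * x) ` digit_sums l n")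
      case True
      then obtain x where "x \<in> digit_sums l n" "s = l * x" by blast
      then show ?thesis by (intro exI[of _ x] exI[of _ 0]) simp
    next
      case False
      then obtain x where "x \<in> digit_sums l n" "s = l * (1 + x)" using Suc.prems by auto
      then show ?thesis by (intro exI[of _ x] exI[of _ 1]) simp
    qed
    then obtain x a where x: "x \<in> digit_sums l n" "s = l * (a + x)" "a = 0 \<or> a = (1::real)" by blast
    have "s \<le> l * (1 + l / (1 - l))"
      unfolding x(2) using Suc.IH[OF x(1)] x(3) l by (intro mult_left_mono) auto
    then show ?case using L Suc.IH[OF x(1)] x l by auto
  qed
  then show "0 \<le> s" "s \<le> l / (1 - l)" by auto
qed

text \<open>Greedy expansion: one digit is removed at a time, and the rescaled remainder stays in
  \<open>[0, l / (1 - l)]\<close> since this interval has length at least 1.\<close>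

lemma digit_sums_dense:
  assumes l: "1 / 2 \<le> l" "l < 1" and x: "0 \<le> x" "x \<le> l / (1 - l)"
  shows "\<exists>s\<in>digit_sums l n. s \<le> x \<and> x \<le> s + l ^ n * (l / (1 - l))"
  using x
proof (induction n arbitrary: x)
  case (Suc n)
  define L where "L = l / (1 - l)"
  have L: "1 \<le> L" "L / l = 1 + L" using l by (auto simp: L_def field_simps)
  \<comment> \<open>The digit is 1 only if \<open>x / l > L\<close>, and then
    \<open>x / l - 1\<close> is nonnegative because \<open>L \<ge> 1\<close>.\<close>
  define a :: real where "a = (if x / l \<le> L then 0 else 1)"
  have "x / l \<le> L / l" using Suc.prems l by (intro divide_right_mono) (auto simp: L_def)
  then have xl: "0 \<le> x / l" "x / l \<le> 1 + L" using Suc.prems l L(2) by auto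
  then have "0 \<le> x / l - a" "x / l - a \<le> L" using L by (auto simp: a_def)
  then obtain s where s: "s \<in> digit_sums l n" "s \<le> x / l - a" "x / l - a \<le> s + l ^ n * L"
    using Suc.IH[of "x / l - a"] by (auto simp: L_def)
  have l0: "0 < l" using l by simp
  have "l * (a + s) \<in> digit_sums l (Suc n)" using s(1) by (auto simp: a_def)
  moreover have "l * (a + s) \<le> x" using s(2) l0 by (simp add: field_simps)
  moreover have "x \<le> l * (a + s) + l ^ Suc n * L"
  proof -
    have "x = l * (x / l)" using l0 by simp
    also have "\<dots> \<le> l * (a + s + l ^ n * L)" using s(3) l0 by (intro mult_left_mono) auto
    finally show ?thesis by (simp add: algebra_simps)
  qed
  ultimately show ?case unfolding L_def by blast
qed simp

section \<open>Link to \<open>W_set\<close> and the upper bound for its dimension\<close>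

lemma digit_sums_eq_image:
  "digit_sums l n = (\<lambda>\<omega>. \<Sum>i=1..n. \<omega> i * l ^ i) ` ({1..n} \<rightarrow>\<^sub>E {0, 1})"
proof (induction n)
  case (Suc n)
  have "(\<lambda>\<omega>. \<Sum>i=1..Suc n. \<omega> i * l ^ i) ` ({1..Suc n} \<rightarrow>\<^sub>E {0, 1}) =
     (\<lambda>(a, \<omega>). (\<Sum>i=1..n. \<omega> i * l ^ i) + a * l ^ Suc n) ` ({0, 1} \<times> ({1..n} \<rightarrow>\<^sub>E {0, 1}))"
  proof -
    have "{1..Suc n} = insert (Suc n) {1..n}" by auto
    then show ?thesis
      unfolding \<open>{1..Suc n} = _\<close> PiE_insert_eq image_image
      by (intro image_cong) (auto intro!: sum.cong)
  qed
  also have "\<dots> = digit_sums l n \<union> (\<lambda>s. s + l ^ Suc n) ` digit_sums l n"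
  proof -
    have "{0, 1::real} \<times> B = Pair 0 ` B \<union> Pair 1 ` B" for B :: "(nat \<Rightarrow> real) set" by auto
    then show ?thesis unfolding Suc.IH by (simp only: image_Un image_image) simp
  qed
  finally show ?case unfolding digit_sums_Suc_last by simp
qed simp

lemma W_set_eq:
  "W_set l \<alpha> = {x \<in> I_interval l. \<forall>m. \<exists>n\<ge>m. \<exists>s\<in>digit_sums l n. \<bar>x - s\<bar> < 2 powr (- real n * \<alpha>)}"
  unfolding W_set_def digit_sums_eq_image by (auto; blast)

text \<open>The natural cover consists of all intervals around digit sums of length at least
  \<open>m\<close>. For \<open>s\<close> above the stated value, its gauge is bounded by the tail of
  a geometric series of ratio \<open>\<gamma> * 2 powr (- \<alpha> * s)\<close>.\<close>

lemma hausdorff_dim_W_set_le: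
  assumes \<alpha>: "0 < \<alpha>" and \<gamma>: "1 \<le> \<gamma>" and card: "\<And>n. real (card (digit_sums l n)) \<le> K * \<gamma> ^ n"
  shows "hausdorff_dim (W_set l \<alpha>) \<le> ennreal (ln \<gamma> / (\<alpha> * ln 2))"
proof (rule ennreal_le_epsilon)
  fix e :: real assume e: "0 < e"
  define s where "s = ln \<gamma> / (\<alpha> * ln 2) + e"
  have s: "0 < s" using \<gamma> \<alpha> e by (auto simp: s_def intro!: add_nonneg_pos)
  define b where "b = \<gamma> * 2 powr (- \<alpha> * s)"
  have b: "0 < b" "b < 1"
  proof -
    show "0 < b" using \<gamma> by (simp add: b_def)
    have "2 powr (- \<alpha> * s) = exp (- ln \<gamma> - \<alpha> * e * ln 2)"
      using \<alpha> by (simp add: powr_def s_def algebra_simps)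
    also have "\<dots> < exp (- ln \<gamma>)" using \<alpha> e by simp
    also have "\<dots> = 1 / \<gamma>" using \<gamma> by (simp add: exp_minus inverse_eq_divide)
    finally show "b < 1" using \<gamma> by (simp add: b_def field_simps)
  qed
  define r where "r n = 2 powr (- real n * \<alpha>)" for n
  have "hausdorff_premeasure s \<delta> (W_set l \<alpha>) = 0" if \<delta>: "0 < \<delta>" for \<delta>
  proof -
    have le: "hausdorff_premeasure s \<delta> (W_set l \<alpha>) \<le> ennreal \<epsilon>" if \<epsilon>: "0 < \<epsilon>" for \<epsilon>
    proof -
      have K: "0 \<le> K" using card[of 0] by simp
      have "(\<lambda>m. 2 powr s * K * b ^ m / (1 - b)) \<longlonglongrightarrow> 2 powr s * K * 0 / (1 - b)"
        using b by (intro tendsto_intros LIMSEQ_power_zero) auto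
      then have ev1: "\<forall>\<^sub>F m in sequentially. 2 powr s * K * b ^ m / (1 - b) < \<epsilon>"
        using \<epsilon> by (intro order_tendstoD) auto
      have "(\<lambda>m. 2 * (2 powr (- \<alpha>)) ^ m) \<longlonglongrightarrow> 2 * 0"
        using \<alpha> by (intro tendsto_intros LIMSEQ_power_zero) (auto simp: powr_minus_divide)
      then have ev2: "\<forall>\<^sub>F m in sequentially. 2 * (2 powr (- \<alpha>)) ^ m < \<delta>"
        using \<delta> by (intro order_tendstoD) auto
      obtain m where m: "2 powr s * K * b ^ m / (1 - b) < \<epsilon>" "2 * (2 powr (- \<alpha>)) ^ m < \<delta>"
        using eventually_happens[OF eventually_conj[OF ev1 ev2]] by auto
      have "\<forall>n. \<exists>c. bij_betw c {0..<card (digit_sums l (n + m))} (digit_sums l (n + m))"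
        using ex_bij_betw_nat_finite finite_digit_sums by blast
      then obtain c where c: "\<And>n. bij_betw (c n) {0..<card (digit_sums l (n + m))} (digit_sums l (n + m))"
        by metis
      define V where "V p = (if snd p < card (digit_sums l (fst p + m))
        then cball (c (fst p) (snd p)) (r (fst p + m)) else {})" for p
      have r0: "0 < r n" for n by (simp add: r_def)
      have r_pow: "r n = (2 powr (- \<alpha>)) ^ n" for n
        by (simp add: r_def powr_realpow[symmetric] powr_powr mult.commute)
      have sub: "W_set l \<alpha> \<subseteq> (\<Union>i. V (prod_decode i))"
      proof
        fix x assume "x \<in> W_set l \<alpha>"
        then obtain n t where n: "n \<ge> m" "t \<in> digit_sums l n" "\<bar>x - t\<bar> < r n"
          unfolding W_set_eq r_def by blast
        obtain k where k: "k < card (digit_sums l n)" "c (n - m) k = t"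
        proof -
          have "t \<in> c (n - m) ` {0..<card (digit_sums l n)}"
            using c[of "n - m"] n by (simp add: bij_betw_def)
          then show ?thesis using that by auto
        qed
        have "x \<in> V (n - m, k)" using n k by (auto simp: V_def dist_real_def)
        then have "x \<in> V (prod_decode (prod_encode (n - m, k)))" by simp
        then show "x \<in> (\<Union>i. V (prod_decode i))" by blast
      qed
      have diam: "bounded (V p) \<and> diameter (V p) \<le> \<delta>" for p
      proof -
        have "r (fst p + m) \<le> (2 powr (- \<alpha>)) ^ m"
          unfolding r_pow using \<alpha> by (intro power_decreasing) (auto simp: powr_minus_divide ge_one_powr_ge_zero less_imp_le)
        then show ?thesis using m(2) r0[of "fst p + m"] \<delta> by (auto simp: V_def diameter_cball)
      qed
      have gauge: "(\<Sum>k. hausdorff_gauge s (V (n, k))) \<le> ennreal (2 powr s * K * b ^ m * b ^ n)" for n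
      proof -
        have "(\<Sum>k. hausdorff_gauge s (V (n, k))) = (\<Sum>k<card (digit_sums l (n + m)). hausdorff_gauge s (V (n, k)))"
          by (intro suminf_finite) (auto simp: V_def hausdorff_gauge_def)
        also have "\<dots> = (\<Sum>k<card (digit_sums l (n + m)). ennreal ((2 * r (n + m)) powr s))"
          using s r0[of "n + m"] by (intro sum.cong) (auto simp: V_def hausdorff_gauge_def diameter_cball)
        also have "\<dots> = ennreal (real (card (digit_sums l (n + m))) * (2 * r (n + m)) powr s)"
          by (simp add: ennreal_of_nat_eq_real_of_nat[symmetric] ennreal_mult)
        also have "\<dots> \<le> ennreal (K * \<gamma> ^ (n + m) * (2 * r (n + m)) powr s)"
          by (intro ennreal_leI mult_right_mono card) auto
        also have "K * \<gamma> ^ (n + m) * (2 * r (n + m)) powr s = 2 powr s * K * b ^ m * b ^ n"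
        proof -
          have "r (n + m) powr s = (2 powr (- \<alpha> * s)) ^ (n + m)"
            by (simp add: r_def powr_realpow[symmetric] powr_powr algebra_simps)
          then show ?thesis
            using r0[of "n + m"] by (simp add: b_def powr_mult power_mult_distrib power_add)
        qed
        finally show ?thesis .
      qed
      have "hausdorff_premeasure s \<delta> (W_set l \<alpha>) \<le> (\<Sum>i. hausdorff_gauge s (V (prod_decode i)))"
        unfolding hausdorff_premeasure_def using sub diam by (intro INF_lower) auto
      also have "\<dots> = (\<Sum>n. \<Sum>k. hausdorff_gauge s (V (n, k)))"
        using suminf_ennreal_2dimen[of "\<lambda>n. \<Sum>k. hausdorff_gauge s (V (n, k))" "\<lambda>p. hausdorff_gauge s (V p)"]
        by simp
      also have "\<dots> \<le> (\<Sum>n. ennreal (2 powr s * K * b ^ m * b ^ n))"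
        by (intro suminf_le gauge) auto
      also have "\<dots> = ennreal (2 powr s * K * b ^ m * (1 / (1 - b)))"
        using b K by (intro suminf_ennreal_eq sums_mult geometric_sums) auto
      also have "\<dots> \<le> ennreal \<epsilon>" using m(1) by (intro ennreal_leI) simp
      finally show ?thesis .
    qed
    have "hausdorff_premeasure s \<delta> (W_set l \<alpha>) \<le> 0"
    proof (rule ennreal_le_epsilon)
      show "hausdorff_premeasure s \<delta> (W_set l \<alpha>) \<le> 0 + ennreal e" if "0 < e" for e
        using le[OF that] by simp
    qed
    then show ?thesis by simp
  qed
  then have "hausdorff_measure s (W_set l \<alpha>) = 0" unfolding hausdorff_measure_def by simp
  then have "hausdorff_dim (W_set l \<alpha>) \<le> ennreal s"
    unfolding hausdorff_dim_def using s by (intro Inf_lower) (auto intro!: exI[of _ s])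
  also have "ennreal s = ennreal (ln \<gamma> / (\<alpha> * ln 2)) + ennreal e"
    using \<gamma> \<alpha> e by (simp add: s_def)
  finally show "hausdorff_dim (W_set l \<alpha>) \<le> ennreal (ln \<gamma> / (\<alpha> * ln 2)) + ennreal e" .
qed

section \<open>Large open sets from well-spread digit sums\<close>

text \<open>On the line, the distances of \<open>f x\<close> to \<open>f 0\<close> and
  \<open>f 1\<close> determine \<open>f x\<close>.\<close>

lemma similarity_real_affine:
  fixes f :: "real \<Rightarrow> real"
  assumes "similarity f"
  shows "\<exists>b c. c \<noteq> 0 \<and> f = (\<lambda>x. b + c * x)"
proof -
  obtain c where c: "0 < c" "\<And>x y. \<bar>f x - f y\<bar> = c * \<bar>x - y\<bar>"
    using assms by (auto simp: similarity_def dist_real_def)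
  define e where "e = f 1 - f 0"
  have e: "\<bar>e\<bar> = c" using c(2)[of 1 0] by (simp add: e_def)
  have f: "f = (\<lambda>x. f 0 + e * x)"
  proof
    fix x
    define u where "u = f x - f 0"
    have sq: "v\<^sup>2 = c\<^sup>2 * w\<^sup>2" if "\<bar>v\<bar> = c * \<bar>w\<bar>" for v w
    proof -
      have "v\<^sup>2 = (c * \<bar>w\<bar>)\<^sup>2" using that by (metis power2_abs)
      then show ?thesis by (simp add: power_mult_distrib)
    qed
    have "u\<^sup>2 = c\<^sup>2 * x\<^sup>2" using sq[of u x] c(2)[of x 0] by (simp add: u_def)
    moreover have "(u - e)\<^sup>2 = c\<^sup>2 * (x - 1)\<^sup>2" using sq[of "u - e" "x - 1"] c(2)[of x 1] by (simp add: u_def e_def)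
    moreover have "e\<^sup>2 = c\<^sup>2" using e by (metis power2_abs)
    moreover have "c\<^sup>2 * (x - 1)\<^sup>2 = c\<^sup>2 * x\<^sup>2 - 2 * (c\<^sup>2 * x) + c\<^sup>2"
      by (simp add: power2_diff algebra_simps)
    moreover have "(u - e)\<^sup>2 = u\<^sup>2 - 2 * (e * u) + e\<^sup>2" by (simp add: power2_diff algebra_simps)
    \<comment> \<open>Subtracting the two quadratic equations cancels the squares and leaves a
      linear equation for \<open>u\<close>.\<close>
    ultimately have "e * u = e\<^sup>2 * x" by simp
    then have "e * (f x - f 0) = e * (e * x)" by (simp add: power2_eq_square u_def)
    then show "f x = f 0 + e * x" using e c(1) by auto
  qed
  have "e \<noteq> 0" using e c(1) by auto
  show ?thesis
  proof (intro exI)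
    show "e \<noteq> 0 \<and> f = (\<lambda>x. f 0 + e * x)" by (rule conjI) fact+
  qed
qed

text \<open>The counts involve \<open>r\<close> and \<open>h\<close> only through their ratio, so
  \<open>C\<close> survives the scaling, while \<open>\<delta>\<close> is multiplied by
  \<open>\<bar>c\<bar>\<close>.\<close>

lemma large_in_affine:
  assumes "large_in t A" and c: "c \<noteq> 0"
  shows "large_in t ((\<lambda>x. b + c * x) ` A)"
proof -
  obtain C \<delta> where C: "0 < C" and \<delta>: "0 < \<delta>"
    and fam: "\<And>a h \<epsilon>. 0 < h \<Longrightarrow> h \<le> \<delta> \<Longrightarrow> 0 < \<epsilon> \<Longrightarrow> \<exists>N x \<rho>. spread_family t C A a h \<epsilon> N x \<rho>"
    using assms(1) unfolding large_in_def by metis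
  have "\<exists>N x \<rho>. spread_family t C ((\<lambda>x. b + c * x) ` A) a h \<epsilon> N x \<rho>"
    if h: "0 < h" "h \<le> \<delta> * \<bar>c\<bar>" and \<epsilon>: "0 < \<epsilon>" for a h \<epsilon>
  proof -
    \<comment> \<open>The first bound serves the radius \<open>\<bar>c\<bar> * \<rho>\<close>, the
      second the factor \<open>\<bar>c\<bar> powr t\<close> that \<open>\<rho> powr t\<close> picks
      up.\<close>
    define \<epsilon>' where "\<epsilon>' = min (\<epsilon> / \<bar>c\<bar>) (\<epsilon> * \<bar>c\<bar> powr t)"
    have "0 < \<epsilon>'" using \<epsilon> c by (simp add: \<epsilon>'_def)
    moreover have "0 < h / \<bar>c\<bar>" "h / \<bar>c\<bar> \<le> \<delta>" using h c by (auto simp: field_simps)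
    ultimately obtain N x \<rho> where "spread_family t C A ((a - b) / c) (h / \<bar>c\<bar>) \<epsilon>' N x \<rho>"
      using fam by blast
    then have N: "0 < N" and \<rho>: "0 < \<rho>" "\<rho> < \<epsilon>'"
      and sub: "\<And>j. j < N \<Longrightarrow> cball (x j) \<rho> \<subseteq> cball ((a - b) / c) (h / \<bar>c\<bar>) \<inter> A"
      and big: "\<And>y r. \<rho> \<le> r \<Longrightarrow> real (card {i. i < N \<and> \<bar>x i - y\<bar> \<le> r}) \<le> C * (r / (h / \<bar>c\<bar>)) powr t * real N"
      and small: "\<And>y. real (card {i. i < N \<and> \<bar>x i - y\<bar> \<le> 2 * \<rho>}) \<le> \<epsilon>' * \<rho> powr t * real N"
      unfolding spread_family_def by blast+
    have scale: "\<bar>b + c * u - z\<bar> \<le> r \<longleftrightarrow> \<bar>u - (z - b) / c\<bar> \<le> r / \<bar>c\<bar>" for u z r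
    proof -
      have "b + c * u - z = c * (u - (z - b) / c)" using c by (simp add: field_simps)
      then have "\<bar>b + c * u - z\<bar> = \<bar>c\<bar> * \<bar>u - (z - b) / c\<bar>" by (simp only: abs_mult)
      then show ?thesis using c by (simp add: field_simps)
    qed
    have scale': "\<bar>b + c * u - z\<bar> \<le> \<bar>c\<bar> * r \<longleftrightarrow> \<bar>u - (z - b) / c\<bar> \<le> r" for u z r
      using scale[of u z "\<bar>c\<bar> * r"] c by simp
    have "spread_family t C ((\<lambda>x. b + c * x) ` A) a h \<epsilon> N (\<lambda>i. b + c * x i) (\<bar>c\<bar> * \<rho>)"
      unfolding spread_family_def
    proof (intro conjI allI impI)
      show "0 < N" by fact
      show "0 < \<bar>c\<bar> * \<rho>" using c \<rho> by simp
      show "\<bar>c\<bar> * \<rho> < \<epsilon>"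
      proof -
        have "\<rho> < \<epsilon> / \<bar>c\<bar>" using \<rho> by (simp add: \<epsilon>'_def)
        then show ?thesis using c by (simp add: field_simps)
      qed
    next
      fix i assume i: "i < N"
      show "cball (b + c * x i) (\<bar>c\<bar> * \<rho>) \<subseteq> cball a h \<inter> (\<lambda>x. b + c * x) ` A"
      proof
        fix z assume "z \<in> cball (b + c * x i) (\<bar>c\<bar> * \<rho>)"
        then have "(z - b) / c \<in> cball (x i) \<rho>" using scale' by (auto simp: dist_real_def)
        then have w: "(z - b) / c \<in> cball ((a - b) / c) (h / \<bar>c\<bar>)" "(z - b) / c \<in> A"
          using sub[OF i] by auto
        have z: "z = b + c * ((z - b) / c)" using c by simp
        have "\<bar>(z - b) / c - (a - b) / c\<bar> \<le> h / \<bar>c\<bar>" using w(1) by (simp add: dist_real_def abs_minus_commute)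
        then have "\<bar>b + c * ((z - b) / c) - a\<bar> \<le> h" using scale by blast
        then have "z \<in> cball a h" using z by (simp add: dist_real_def abs_minus_commute)
        then show "z \<in> cball a h \<inter> (\<lambda>x. b + c * x) ` A" using w(2) z by blast
      qed
    next
      fix y r assume "\<bar>c\<bar> * \<rho> \<le> r"
      then have "\<rho> \<le> r / \<bar>c\<bar>" using c by (simp add: field_simps)
      from big[OF this, of "(y - b) / c"]
      show "real (card {i. i < N \<and> \<bar>b + c * x i - y\<bar> \<le> r}) \<le> C * (r / h) powr t * real N"
        using c by (simp add: scale)
    next
      fix y
      have "real (card {i. i < N \<and> \<bar>b + c * x i - y\<bar> \<le> 2 * (\<bar>c\<bar> * \<rho>)}) \<le> \<epsilon>' * \<rho> powr t * real N"
        using small[of "(y - b) / c"] scale'[of _ y "2 * \<rho>"] by (simp add: mult.left_commute)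
      also have "\<dots> \<le> \<epsilon> * \<bar>c\<bar> powr t * \<rho> powr t * real N"
        by (intro mult_right_mono) (auto simp: \<epsilon>'_def)
      also have "\<dots> = \<epsilon> * (\<bar>c\<bar> * \<rho>) powr t * real N" using \<rho> by (simp add: powr_mult)
      finally show "real (card {i. i < N \<and> \<bar>b + c * x i - y\<bar> \<le> 2 * (\<bar>c\<bar> * \<rho>)})
          \<le> \<epsilon> * (\<bar>c\<bar> * \<rho>) powr t * real N" .
    qed
    then show ?thesis by blast
  qed
  then show ?thesis unfolding large_in_def using C \<delta> c
    by (intro exI[of _ C] conjI exI[of _ "\<delta> * \<bar>c\<bar>"] allI impI) auto
qed

text \<open>
  The endpoints of the period intervals are left out, so that a point determines the translate \<open>k\<close>.
\<close>

definition approx_open :: "real \<Rightarrow> real \<Rightarrow> nat \<Rightarrow> real set" where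
  "approx_open l \<alpha> m = (\<Union>k::int. {x. k * (l / (1 - l)) < x \<and> x < (k + 1) * (l / (1 - l)) \<and>
     (\<exists>n\<ge>m. \<exists>s\<in>digit_sums l n. \<bar>x - k * (l / (1 - l)) - s\<bar> < 2 powr (- real n * \<alpha>))})"

text \<open>A discrete Frostman condition of exponent \<open>\<sigma>\<close> on some digit sums of
  length \<open>n\<close>, down to scale \<open>\<theta> ^ n\<close>. Infinitely many
  \<open>n\<close> suffice because the target is a limsup set.\<close>

definition well_spread :: "real \<Rightarrow> real \<Rightarrow> real \<Rightarrow> bool" where
  "well_spread l \<theta> \<sigma> \<longleftrightarrow> (\<exists>C. \<forall>n0. \<exists>n\<ge>n0. \<exists>N x. 0 < N \<and> (\<forall>i<N. x i \<in> digit_sums l n) \<and>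
     (\<forall>y r. \<theta> ^ n \<le> r \<longrightarrow> real (card {i. i < N \<and> \<bar>x i - y\<bar> \<le> r}) \<le> C * r powr \<sigma> * real N))"

lemma two_powr_minus: "2 powr (- real n * \<alpha>) = (2 powr (- \<alpha>)) ^ n"
  by (simp add: powr_realpow[symmetric] powr_powr mult.commute)

text \<open>By self-similarity every short interval contains a copy of the digit sums of length
  \<open>n\<close>, scaled by \<open>l ^ q\<close> with \<open>l ^ q * L\<close> comparable to
  \<open>h\<close>. The copy inherits the spread, and \<open>small\<close> makes the proportion
  \<open>(\<theta> ^ n) powr \<sigma>\<close> at the finest scale negligible against
  \<open>\<rho> n powr t\<close>.\<close>

lemma large_in_approx_open:
  assumes l: "1 / 2 < l" "l < 1" and \<alpha>: "1 \<le> \<alpha>" and \<theta>: "1 / 2 \<le> \<theta>" "\<theta> < 1"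
    and t: "0 < t" "t \<le> \<sigma>" and spread: "well_spread l \<theta> \<sigma>"
    and small: "\<theta> powr \<sigma> * 2 powr (\<alpha> * t) < 1"
  shows "large_in t (approx_open l \<alpha> m)"
proof -
  define L where "L = l / (1 - l)"
  have L: "1 < L" using l by (auto simp: L_def field_simps)
  obtain C0 where C0: "\<And>n0. \<exists>n\<ge>n0. \<exists>N x. 0 < N \<and> (\<forall>i<N. x i \<in> digit_sums l n) \<and>
     (\<forall>y r. \<theta> ^ n \<le> r \<longrightarrow> real (card {i. i < N \<and> \<bar>x i - y\<bar> \<le> r}) \<le> C0 * r powr \<sigma> * real N)"
    using spread unfolding well_spread_def by blast
  define C1 where "C1 = max C0 1"
  define C where "C = C1 * (16 * L) powr \<sigma>"
  have C1: "C0 \<le> C1" "1 \<le> C1" by (auto simp: C1_def)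
  have C: "1 \<le> C"
  proof -
    have "1 \<le> (16 * L) powr \<sigma>" using L t by (intro ge_one_powr_ge_zero) auto
    then show ?thesis unfolding C_def using C1 mult_mono[of 1 C1 1 "(16 * L) powr \<sigma>"] by simp
  qed
  have "\<exists>N x \<rho>. spread_family t C (approx_open l \<alpha> m) a h \<epsilon> N x \<rho>"
    if h: "0 < h" "h \<le> L / 2" and \<epsilon>: "0 < \<epsilon>" for a h \<epsilon>
  proof -
    define k where "k = \<lfloor>a / L\<rfloor>"
    have k: "k * L \<le> a" "a < (k + 1) * L"
      using L floor_divide_lower[of L a] floor_divide_upper[of L a] by (auto simp: k_def)
    \<comment> \<open>\<open>[b, b + h]\<close> is the half of \<open>cball a h\<close> on the side
      that keeps it inside the period, in coordinates relative to \<open>k * L\<close>.\<close>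
    define b where "b = (if a - k * L \<le> L / 2 then a else a - h) - k * L"
    have b: "0 \<le> b" "b + h \<le> L" "a - h \<le> k * L + b" "k * L + b + h \<le> a + h"
      using k h by (auto simp: b_def algebra_simps)
    define P where "P q \<longleftrightarrow> l ^ q * L \<le> h / 8" for q
    have "(\<lambda>q. l ^ q * L) \<longlonglongrightarrow> 0 * L" using l by (intro tendsto_intros LIMSEQ_power_zero) auto
    from order_tendstoD(2)[OF this, of "h / 8"]
    have "\<forall>\<^sub>F q in sequentially. l ^ q * L < h / 8" using h by simp
    then have "\<exists>q. P q" by (auto simp: P_def eventually_sequentially intro: less_imp_le)
    \<comment> \<open>Minimality of \<open>q\<close> and \<open>l > 1 / 2\<close> bound the length
      \<open>l ^ q * L\<close> of the copy from below by \<open>h / 16\<close>.\<close>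
    define q where "q = (LEAST q. P q)"
    have q: "P q" unfolding q_def using \<open>\<exists>q. P q\<close> by (rule LeastI_ex)
    have "q \<noteq> 0"
    proof
      assume "q = 0"
      then have "L \<le> h / 8" using q by (simp add: P_def)
      then show False using h L by linarith
    qed
    then have "\<not> P (q - 1)" using not_less_Least[of "q - 1" P] by (simp add: q_def)
    then have "h / 8 < l ^ (q - 1) * L" by (simp add: P_def)
    then have "l * (h / 8) < l ^ q * L"
      using \<open>q \<noteq> 0\<close> l mult_strict_left_mono[of "h / 8" "l ^ (q - 1) * L" l] by (cases q) auto
    moreover have "1 / 2 * (h / 8) \<le> l * (h / 8)" using l h by (intro mult_right_mono) auto
    ultimately have q_ge: "h / 16 < l ^ q * L" by linarith
    define w where "w = l ^ q"
    have w: "0 < w" "w * L \<le> h / 8" "h / 16 < w * L" using q q_ge l by (auto simp: w_def P_def)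
    obtain p where p: "p \<in> digit_sums l q" "p \<le> b + h / 2" "b + h / 2 \<le> p + w * L"
      using digit_sums_dense[of l "b + h / 2" q] l b h by (auto simp: w_def L_def)
    \<comment> \<open>Half the approximation radius, so that closed balls satisfy the strict
      inequality in \<open>approx_open\<close>.\<close>
    define \<rho> where "\<rho> n = 2 powr (- real (n + q) * \<alpha>) / 2" for n
    have \<rho>0: "0 < \<rho> n" for n by (simp add: \<rho>_def)
    have \<rho>_pow: "\<rho> n = (2 powr (- \<alpha>)) ^ (n + q) / 2" for n
      by (simp only: \<rho>_def two_powr_minus)
    have "(\<lambda>n. (2 powr (- \<alpha>)) ^ (n + q) / 2) \<longlonglongrightarrow> 0 / 2"
      using \<alpha> by (intro tendsto_intros LIMSEQ_ignore_initial_segment LIMSEQ_power_zero)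
        (auto simp: powr_minus_divide)
    then have "\<rho> \<longlonglongrightarrow> 0" unfolding \<rho>_pow[abs_def] by simp
    from order_tendstoD(2)[OF this, of "min \<epsilon> (h / 8)"]
    have ev1: "\<forall>\<^sub>F n in sequentially. \<rho> n < min \<epsilon> (h / 8)" using \<epsilon> h by simp
    \<comment> \<open>The bound \<open>h powr (- t)\<close> brings the counts at radii below the
      finest scale of the copy under \<open>(r / h) powr t\<close>.\<close>
    define \<epsilon>1 where "\<epsilon>1 = min \<epsilon> (h powr (- t))"
    have \<epsilon>1: "0 < \<epsilon>1" "\<epsilon>1 \<le> \<epsilon>" "\<epsilon>1 \<le> h powr (- t)" using \<epsilon> h by (auto simp: \<epsilon>1_def)
    define D where "D = C1 * 2 powr t * 2 powr (q * \<alpha> * t)"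
    have ratio: "C1 * (\<theta> ^ n) powr \<sigma> = D * (\<theta> powr \<sigma> * 2 powr (\<alpha> * t)) ^ n * \<rho> n powr t" for n
    proof -
      have "(\<theta> ^ n) powr \<sigma> = (\<theta> powr \<sigma>) ^ n"
        using \<theta> by (simp add: powr_realpow[symmetric] powr_powr mult.commute)
      moreover have "(2 powr (\<alpha> * t)) ^ n = 2 powr (real n * \<alpha> * t)"
        by (simp add: powr_realpow[symmetric] powr_powr algebra_simps)
      moreover have "\<rho> n powr t = 2 powr (- real (n + q) * \<alpha> * t) / 2 powr t"
        by (simp add: \<rho>_def powr_divide powr_powr)
      moreover have "2 powr (q * \<alpha> * t) * 2 powr (real n * \<alpha> * t) * 2 powr (- real (n + q) * \<alpha> * t) = 1"
        by (simp add: powr_add[symmetric] algebra_simps)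
      ultimately show ?thesis by (simp add: D_def power_mult_distrib mult_ac)
    qed
    have "(\<lambda>n. D * (\<theta> powr \<sigma> * 2 powr (\<alpha> * t)) ^ n) \<longlonglongrightarrow> D * 0"
      using small by (intro tendsto_intros LIMSEQ_power_zero) auto
    from order_tendstoD(2)[OF this, of \<epsilon>1]
    have ev2: "\<forall>\<^sub>F n in sequentially. D * (\<theta> powr \<sigma> * 2 powr (\<alpha> * t)) ^ n < \<epsilon>1" using \<epsilon>1 by simp
    obtain n0 where n0: "\<And>n. n0 \<le> n \<Longrightarrow> \<rho> n < min \<epsilon> (h / 8) \<and> D * (\<theta> powr \<sigma> * 2 powr (\<alpha> * t)) ^ n < \<epsilon>1"
      using eventually_conj[OF ev1 ev2] unfolding eventually_sequentially by blast
    obtain n N x where n: "max n0 m \<le> n" and N: "0 < N" and x: "\<And>i. i < N \<Longrightarrow> x i \<in> digit_sums l n"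
      and cnt0: "\<And>y r. \<theta> ^ n \<le> r \<Longrightarrow> real (card {i. i < N \<and> \<bar>x i - y\<bar> \<le> r}) \<le> C0 * r powr \<sigma> * real N"
      using C0[of "max n0 m"] by blast
    have \<rho>n: "\<rho> n < \<epsilon>" "\<rho> n \<le> h / 8" using n0[of n] n by auto
    have tiny: "C1 * (\<theta> ^ n) powr \<sigma> \<le> \<epsilon>1 * \<rho> n powr t"
      unfolding ratio using n0[of n] n by (intro mult_right_mono) auto
    have cnt: "real (card {i. i < N \<and> \<bar>x i - y\<bar> \<le> r}) \<le> C1 * r powr \<sigma> * real N" if "\<theta> ^ n \<le> r" for y r
    proof -
      have "C0 * r powr \<sigma> * real N \<le> C1 * r powr \<sigma> * real N" using C1 by (intro mult_right_mono) auto
      then show ?thesis using cnt0[OF that, of y] by linarith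
    qed
    define z where "z i = k * L + p + w * x i" for i
    have z_count: "{i. i < N \<and> \<bar>z i - y\<bar> \<le> r} = {i. i < N \<and> \<bar>x i - (y - k * L - p) / w\<bar> \<le> r / w}" for y r
    proof -
      have "\<bar>z i - y\<bar> = w * \<bar>x i - (y - k * L - p) / w\<bar>" for i
      proof -
        have "z i - y = w * (x i - (y - k * L - p) / w)" using w by (simp add: z_def field_simps)
        then show ?thesis using w by (simp add: abs_mult)
      qed
      then show ?thesis using w by (simp add: field_simps)
    qed
    have z_tiny: "real (card {i. i < N \<and> \<bar>z i - y\<bar> \<le> r}) \<le> \<epsilon>1 * \<rho> n powr t * real N"
      if "r / w \<le> \<theta> ^ n" for y r
    proof -
      define y' where "y' = (y - k * L - p) / w"
      have "card {i. i < N \<and> \<bar>z i - y\<bar> \<le> r} \<le> card {i. i < N \<and> \<bar>x i - y'\<bar> \<le> \<theta> ^ n}"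
        unfolding z_count y'_def using that by (intro card_mono) auto
      also have "real \<dots> \<le> C1 * (\<theta> ^ n) powr \<sigma> * real N" by (intro cnt) simp
      also have "\<dots> \<le> \<epsilon>1 * \<rho> n powr t * real N" using tiny by (intro mult_right_mono) auto
      finally show ?thesis by simp
    qed
    have "spread_family t C (approx_open l \<alpha> m) a h \<epsilon> N z (\<rho> n)"
      unfolding spread_family_def
    proof (intro conjI allI impI)
      show "0 < N" "0 < \<rho> n" "\<rho> n < \<epsilon>" by fact+
    next
      fix i assume i: "i < N"
      have "0 \<le> x i" "x i \<le> L" using digit_sums_bounds[OF _ _ x[OF i]] l by (simp_all add: L_def)
      then have xi: "0 \<le> w * x i" "w * x i \<le> w * L" using w(1) by (simp_all add: mult_left_mono)
      show "cball (z i) (\<rho> n) \<subseteq> cball a h \<inter> approx_open l \<alpha> m"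
      proof
        fix u assume "u \<in> cball (z i) (\<rho> n)"
        then have u: "\<bar>u - z i\<bar> \<le> \<rho> n" by (simp add: dist_real_def abs_minus_commute)
        \<comment> \<open>The copy lies in the middle quarter of \<open>[b, b + h]\<close>, and
          \<open>\<rho> n \<le> h / 8\<close> keeps \<open>u\<close> in the middle half, off the
          endpoints of the period.\<close>
        then have u': "b + h / 4 \<le> u - k * L" "u - k * L \<le> b + 3 / 4 * h"
          using \<rho>n xi p w unfolding z_def by linarith+
        have 1: "u \<in> cball a h" using u' b h by (auto simp: dist_real_def abs_le_iff)
        have 2: "k * L < u" "u < (k + 1) * L" using u' b h by (auto simp: algebra_simps)
        have 3: "p + w * x i \<in> digit_sums l (q + n)"
          unfolding digit_sums_add w_def using p x[OF i] by blast
        have 4: "\<bar>u - k * L - (p + w * x i)\<bar> < 2 powr (- real (q + n) * \<alpha>)"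
        proof -
          have "2 powr (- real (q + n) * \<alpha>) = 2 * \<rho> n" by (simp add: \<rho>_def add.commute)
          moreover have "u - k * L - (p + w * x i) = u - z i" by (simp add: z_def)
          ultimately show ?thesis using u \<rho>0[of n] by linarith
        qed
        have 5: "m \<le> q + n" using n by simp
        have "u \<in> approx_open l \<alpha> m"
          unfolding approx_open_def L_def[symmetric]
        proof (rule UN_I[of k], simp, rule CollectI, intro conjI exI)
          show "\<exists>s\<in>digit_sums l (q + n). \<bar>u - k * L - s\<bar> < 2 powr (- real (q + n) * \<alpha>)"
            using 3 4 by (rule bexI[rotated])
        qed (use 2 5 in auto)
        with 1 show "u \<in> cball a h \<inter> approx_open l \<alpha> m" by blast
      qed
    next
      fix y r assume r: "\<rho> n \<le> r"
      have r0: "0 < r" using r \<rho>0[of n] by linarith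
      show "real (card {i. i < N \<and> \<bar>z i - y\<bar> \<le> r}) \<le> C * (r / h) powr t * real N"
      proof (cases "h \<le> r")
        case True
        have "card {i. i < N \<and> \<bar>z i - y\<bar> \<le> r} \<le> card {..<N}" by (intro card_mono) auto
        moreover have "1 \<le> C * (r / h) powr t"
          using C True h t mult_mono[of 1 C 1 "(r / h) powr t"] by (simp add: ge_one_powr_ge_zero)
        then have "1 * real N \<le> C * (r / h) powr t * real N" by (intro mult_right_mono) auto
        ultimately show ?thesis by simp
      next
        case False
        show ?thesis
        proof (cases "r / w \<le> \<theta> ^ n")
          case True
          have "\<epsilon>1 * \<rho> n powr t \<le> h powr (- t) * r powr t"
            using \<epsilon>1 r \<rho>0[of n] t by (intro mult_mono powr_mono2) auto
          also have "\<dots> = 1 * (r / h) powr t" using r0 h by (simp add: powr_divide powr_minus_divide)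
          also have "\<dots> \<le> C * (r / h) powr t" using C by (intro mult_right_mono) auto
          finally have "\<epsilon>1 * \<rho> n powr t * real N \<le> C * (r / h) powr t * real N"
            by (intro mult_right_mono) auto
          then show ?thesis using z_tiny[OF True, of y] by linarith
        next
          case r_large: False
          have "r / w \<le> 16 * L * (r / h)"
          proof -
            have "r * h \<le> r * (16 * (w * L))" using w r0 by (intro mult_left_mono) auto
            then show ?thesis using w h by (simp add: field_simps)
          qed
          then have "(r / w) powr \<sigma> \<le> (16 * L * (r / h)) powr \<sigma>"
            using r0 w t by (intro powr_mono2) auto
          also have "\<dots> = (16 * L) powr \<sigma> * (r / h) powr \<sigma>" by (rule powr_mult)
          also have "\<dots> \<le> (16 * L) powr \<sigma> * (r / h) powr t"
            using False r0 h t by (intro mult_left_mono powr_mono') auto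
          finally have "C1 * (r / w) powr \<sigma> \<le> C * (r / h) powr t"
            unfolding C_def using C1 by (simp add: mult.assoc)
          then have "C1 * (r / w) powr \<sigma> * real N \<le> C * (r / h) powr t * real N"
            by (intro mult_right_mono) auto
          then show ?thesis using cnt[of "r / w" "(y - k * L - p) / w"] r_large unfolding z_count by simp
        qed
      qed
    next
      fix y
      \<comment> \<open>\<open>\<alpha> \<ge> 1\<close> gives
        \<open>2 * \<rho> n \<le> (1 / 2) ^ (n + q)\<close>, and both \<open>\<theta>\<close> and
        \<open>l\<close> are at least 1/2.\<close>
      have "2 * \<rho> n / w \<le> \<theta> ^ n"
      proof -
        have "2 * \<rho> n = (2 powr (- \<alpha>)) ^ (n + q)" by (simp add: \<rho>_pow)
        also have "\<dots> \<le> (1 / 2) ^ (n + q)"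
        proof (rule power_mono)
          have "2 powr (- \<alpha>) \<le> 2 powr (- 1)" using \<alpha> by (intro powr_mono) auto
          then show "2 powr (- \<alpha>) \<le> 1 / 2" by (simp add: powr_minus_divide)
        qed simp
        also have "\<dots> = (1 / 2) ^ n * (1 / 2) ^ q" by (simp add: power_add)
        also have "\<dots> \<le> \<theta> ^ n * w"
          unfolding w_def using \<theta> l by (intro mult_mono power_mono) auto
        finally show ?thesis using w by (simp add: field_simps)
      qed
      then have "real (card {i. i < N \<and> \<bar>z i - y\<bar> \<le> 2 * \<rho> n}) \<le> \<epsilon>1 * \<rho> n powr t * real N"
        by (rule z_tiny)
      also have "\<dots> \<le> \<epsilon> * \<rho> n powr t * real N" using \<epsilon>1 by (intro mult_right_mono) auto
      finally show "real (card {i. i < N \<and> \<bar>z i - y\<bar> \<le> 2 * \<rho> n}) \<le> \<epsilon> * \<rho> n powr t * real N" .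
    qed
    then show ?thesis by blast
  qed
  then show ?thesis unfolding large_in_def using C L
    by (intro exI[of _ C] conjI exI[of _ "L / 2"] allI impI) auto
qed

section \<open>Membership in the Falconer classes\<close>

text \<open>A point of an open period interval determines the index \<open>k\<close>, so the
  translates found for the various \<open>m\<close> agree.\<close>

lemma Inter_approx_open_subset:
  assumes l: "1 / 2 < l" "l < 1"
  shows "(\<Inter>m. approx_open l \<alpha> m) \<subseteq> {a + diameter (I_interval l) * of_int k | a (k::int). a \<in> W_set l \<alpha>}"
proof
  define L where "L = l / (1 - l)"
  have L: "1 < L" using l by (auto simp: L_def field_simps)
  have diam: "diameter (I_interval l) = L" using L by (simp add: I_interval_def L_def)
  fix z assume z: "z \<in> (\<Inter>m. approx_open l \<alpha> m)"
  define A where "A k m \<longleftrightarrow> k * L < z \<and> z < (k + 1) * L \<and>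
     (\<exists>n\<ge>m. \<exists>s\<in>digit_sums l n. \<bar>z - k * L - s\<bar> < 2 powr (- real n * \<alpha>))" for k :: int and m
  have ex: "\<exists>k. A k m" for m
  proof -
    have "z \<in> approx_open l \<alpha> m" using z by blast
    then show ?thesis unfolding approx_open_def A_def L_def UN_iff mem_Collect_eq by simp
  qed
  have k_eq: "k = \<lfloor>z / L\<rfloor>" if "A k m" for k m
  proof -
    have "of_int k \<le> z / L" "z / L < of_int k + 1" using that L by (auto simp: A_def field_simps)
    then show ?thesis by linarith
  qed
  define k where "k = \<lfloor>z / L\<rfloor>"
  have A: "A k m" for m using ex[of m] k_eq by (auto simp: k_def)
  have "z - k * L \<in> I_interval l" using A[of 0] by (auto simp: A_def I_interval_def L_def[symmetric] algebra_simps)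
  moreover have "\<forall>m. \<exists>n\<ge>m. \<exists>s\<in>digit_sums l n. \<bar>z - k * L - s\<bar> < 2 powr (- real n * \<alpha>)"
    using A by (auto simp: A_def)
  ultimately have "z - k * L \<in> W_set l \<alpha>" unfolding W_set_eq by (intro CollectI conjI)
  moreover have "z = (z - k * L) + L * k" by (simp add: mult.commute)
  ultimately show "z \<in> {a + diameter (I_interval l) * of_int k | a (k::int). a \<in> W_set l \<alpha>}"
    unfolding diam by blast
qed

section \<open>The periodised set is a G-delta set\<close>

lemma gdelta_iff_gdelta_in: "gdelta S \<longleftrightarrow> gdelta_in euclidean S"
proof
  assume "gdelta S"
  then obtain F where F: "\<And>n::nat. open (F n)" "S = \<Inter>(range F)" by (auto elim: gdelta.cases)
  show "gdelta_in euclidean S" unfolding F(2)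
    by (intro gdelta_in_Inter) (auto intro!: open_imp_gdelta_in simp: F(1))
next
  assume "gdelta_in euclidean S"
  then obtain C :: "nat \<Rightarrow> 'a set" where C: "\<And>n. open (C n)" "\<Inter>(range C) = S"
    unfolding gdelta_in_descending by auto
  then show "gdelta S" using gdelta.intros[of C] by simp
qed

lemma closed_imp_gdelta_in_euclidean:
  fixes S :: "'a::metric_space set"
  assumes "closed S"
  shows "gdelta_in euclidean S"
  using assms by (intro closed_imp_gdelta_in metrizable_space_euclidean) simp

lemma gdelta_in_translate_W_set: "gdelta_in euclidean {a + c | a. a \<in> W_set l \<alpha>}"
proof -
  define O' where "O' m = (\<Union>n\<in>{m..}. \<Union>s\<in>digit_sums l n. ball (s + c) (2 powr (- real n * \<alpha>)))" for m
  have "{a + c | a. a \<in> W_set l \<alpha>} = {x. x - c \<in> W_set l \<alpha>}" by force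
  also have "\<dots> = {0 + c..l / (1 - l) + c} \<inter> (\<Inter>m. O' m)"
    unfolding W_set_eq O'_def I_interval_def
    by (auto simp: dist_real_def algebra_simps abs_minus_commute; blast)
  finally have eq: "{a + c | a. a \<in> W_set l \<alpha>} = {0 + c..l / (1 - l) + c} \<inter> (\<Inter>m. O' m)" .
  have "gdelta_in euclidean (O' m)" for m unfolding O'_def by (intro open_imp_gdelta_in) auto
  then have "gdelta_in euclidean (\<Inter>m. O' m)" by (intro gdelta_in_Inter) auto
  then show ?thesis unfolding eq
    by (intro gdelta_in_Int[OF closed_imp_gdelta_in_euclidean]) auto
qed

text \<open>A countable union of G-delta sets need not be one, but the translates are locally
  finite: on each period only three of them matter, which turns the union into a countable
  intersection.\<close>

lemma gdelta_periodic_W_set: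
  assumes l: "1 / 2 < l" "l < 1"
  shows "gdelta {a + diameter (I_interval l) * of_int k | a (k::int). a \<in> W_set l \<alpha>}"
proof -
  define L where "L = l / (1 - l)"
  have L: "1 < L" using l by (auto simp: L_def field_simps)
  have diam: "diameter (I_interval l) = L" using L by (simp add: I_interval_def L_def)
  define T where "T k = {a + L * of_int k | a. a \<in> W_set l \<alpha>}" for k :: int
  \<comment> \<open>\<open>G k\<close> restricts only the points of the \<open>k\<close>-th closed
    period; the neighbouring translates enter because closed periods share endpoints.\<close>
  define G where "G k = - {L * k..L * (k + 1)} \<union> (T k \<union> (T (k - 1) \<union> T (k + 1)))" for k :: int
  have T: "L * k \<le> z" "z \<le> L * (k + 1)" if "z \<in> T k" for z k
    using that by (auto simp: T_def W_set_eq I_interval_def L_def[symmetric] algebra_simps)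
  have "{a + L * of_int k | a (k::int). a \<in> W_set l \<alpha>} = (\<Inter>k. G k)"
  proof (intro set_eqI iffI)
    fix z assume "z \<in> {a + L * of_int k | a (k::int). a \<in> W_set l \<alpha>}"
    then obtain j where j: "z \<in> T j" by (auto simp: T_def)
    have "z \<in> G k" for k
    proof (cases "L * k \<le> z \<and> z \<le> L * (k + 1)")
      case True
      then have "L * k \<le> L * (j + 1)" "L * j \<le> L * (k + 1)" using T[OF j] by linarith+
      then have "real_of_int k \<le> j + 1" "real_of_int j \<le> k + 1" using L by simp_all
      then have "j = k \<or> j = k - 1 \<or> j = k + 1" by linarith
      then show ?thesis using j by (auto simp: G_def)
    qed (auto simp: G_def)
    then show "z \<in> (\<Inter>k. G k)" by blast
  next
    fix z assume z: "z \<in> (\<Inter>k. G k)"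
    define k where "k = \<lfloor>z / L\<rfloor>"
    have "L * k \<le> z" "z \<le> L * (k + 1)"
      using L floor_divide_lower[of L z] floor_divide_upper[of L z] by (auto simp: k_def mult.commute)
    moreover have "z \<in> G k" using z by blast
    ultimately have "z \<in> T k \<union> (T (k - 1) \<union> T (k + 1))" by (auto simp: G_def)
    then show "z \<in> {a + L * of_int k | a (k::int). a \<in> W_set l \<alpha>}" unfolding T_def by blast
  qed
  moreover have "gdelta_in euclidean (\<Inter>k. G k)"
  proof (rule gdelta_in_Inter)
    fix S assume "S \<in> range G"
    then obtain k where S: "S = G k" by blast
    have T: "gdelta_in euclidean (T j)" for j unfolding T_def by (rule gdelta_in_translate_W_set)
    show "gdelta_in euclidean S" unfolding S G_def
      by (intro gdelta_in_Un T open_imp_gdelta_in) auto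
  qed auto
  ultimately show ?thesis unfolding diam gdelta_iff_gdelta_in by simp
qed

text \<open>Coding pairs of a similarity and a level by one index turns the intersection of all
  images into one that contains the intersection of a single sequence of large sets.\<close>

lemma W_set_in_falconer_class_on:
  assumes l: "1 / 2 < l" "l < 1"
    and large: "\<And>t m. 0 < t \<Longrightarrow> t < s \<Longrightarrow> large_in t (approx_open l \<alpha> m)"
  shows "W_set l \<alpha> \<in> falconer_class_on s (I_interval l)"
proof -
  define B where "B = {a + diameter (I_interval l) * of_int k | a (k::int). a \<in> W_set l \<alpha>}"
  have "ennreal s \<le> hausdorff_dim (\<Inter>j. f j ` B)" if sim: "\<And>j. similarity (f j)" for f :: "nat \<Rightarrow> real \<Rightarrow> real"
  proof (rule hausdorff_dim_ge)
    fix t :: real assume t: "0 < t" "t < s"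
    define A where "A i = f (fst (prod_decode i)) ` approx_open l \<alpha> (snd (prod_decode i))" for i
    have large_A: "large_in t (A i)" for i
    proof -
      obtain b c where "c \<noteq> 0" "f (fst (prod_decode i)) = (\<lambda>x. b + c * x)"
        using similarity_real_affine[OF sim] by blast
      then show ?thesis unfolding A_def using large_in_affine[OF large[OF t]] by simp
    qed
    have "(\<Inter>k. A k) \<subseteq> (\<Inter>j. f j ` B)"
    proof
      fix z assume z: "z \<in> (\<Inter>k. A k)"
      have "z \<in> f j ` B" for j
      proof -
        obtain b c where bc: "c \<noteq> 0" "f j = (\<lambda>x. b + c * x)"
          using similarity_real_affine[OF sim] by blast
        have "(z - b) / c \<in> approx_open l \<alpha> m" for m
        proof -
          have "z \<in> A (prod_encode (j, m))" using z by blast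
          then show ?thesis using bc by (auto simp: A_def)
        qed
        then have "(z - b) / c \<in> B" using Inter_approx_open_subset[OF l, of \<alpha>] unfolding B_def by blast
        moreover have "z = f j ((z - b) / c)" using bc by simp
        ultimately show ?thesis by blast
      qed
      then show "z \<in> (\<Inter>j. f j ` B)" by blast
    qed
    then have sub: "cball 0 1 \<inter> (\<Inter>k. A k) \<subseteq> (\<Inter>j. f j ` B)" by blast
    show "positive_content t (\<Inter>j. f j ` B)"
      by (rule positive_content_mono[OF positive_content_Inter_large_in[OF t(1) large_A zero_less_one] sub])
  qed
  moreover have "gdelta B" unfolding B_def by (rule gdelta_periodic_W_set[OF l])
  moreover have "W_set l \<alpha> \<subseteq> I_interval l" by (auto simp: W_set_eq)
  ultimately show ?thesis unfolding falconer_class_on_def falconer_class_def B_def by blast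
qed

text \<open>The bound for \<open>W_set\<close> itself rather than its periodisation: the middle half
  of \<open>I_interval\<close> meets only the period \<open>k = 0\<close>.\<close>

lemma hausdorff_dim_W_set_ge:
  assumes l: "1 / 2 < l" "l < 1"
    and large: "\<And>t m. 0 < t \<Longrightarrow> t < s \<Longrightarrow> large_in t (approx_open l \<alpha> m)"
  shows "ennreal s \<le> hausdorff_dim (W_set l \<alpha>)"
proof (rule hausdorff_dim_ge)
  fix t :: real assume t: "0 < t" "t < s"
  define L where "L = l / (1 - l)"
  have L: "1 < L" using l by (auto simp: L_def field_simps)
  have sub: "cball (L / 2) (L / 4) \<inter> (\<Inter>m. approx_open l \<alpha> m) \<subseteq> W_set l \<alpha>"
  proof
    fix z assume z: "z \<in> cball (L / 2) (L / 4) \<inter> (\<Inter>m. approx_open l \<alpha> m)"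
    then have "\<bar>L / 2 - z\<bar> \<le> L / 4" by (simp add: dist_real_def)
    then have z': "L / 4 \<le> z" "z \<le> 3 / 4 * L" by linarith+
    have "\<exists>n\<ge>m. \<exists>s\<in>digit_sums l n. \<bar>z - s\<bar> < 2 powr (- real n * \<alpha>)" for m
    proof -
      have "z \<in> approx_open l \<alpha> m" using z by blast
      then obtain k :: int where k: "real_of_int k * L < z" "z < (real_of_int k + 1) * L"
        "\<exists>n\<ge>m. \<exists>s\<in>digit_sums l n. \<bar>z - k * L - s\<bar> < 2 powr (- real n * \<alpha>)"
        unfolding approx_open_def L_def UN_iff mem_Collect_eq by metis
      have "real_of_int k * L < 1 * L" "0 * L < (real_of_int k + 1) * L" using k z' L by linarith+
      then have "real_of_int k < 1" "0 < real_of_int k + 1"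
        using L by (auto simp: mult_less_cancel_right zero_less_mult_iff)
      then have "k = 0" by linarith
      then show ?thesis using k(3) by simp
    qed
    then show "z \<in> W_set l \<alpha>" using z' L by (auto simp: W_set_eq I_interval_def L_def[symmetric])
  qed
  show "positive_content t (W_set l \<alpha>)"
    by (rule positive_content_mono[OF positive_content_Inter_large_in[OF t(1) large[OF t]] sub]) (use L in simp)
qed

section \<open>Every parameter: evenly spread sums, exact overlaps, multinacci parameters\<close>

lemma card_le_spread:
  fixes S :: "nat set"
  assumes "finite S" "0 \<le> R" and spread: "\<And>i j. i \<in> S \<Longrightarrow> j \<in> S \<Longrightarrow> real i - real j \<le> R"
  shows "real (card S) \<le> R + 1"
proof (cases "S = {}")
  case False
  have "S \<subseteq> {Min S..Min S + nat \<lfloor>R\<rfloor>}"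
  proof
    fix i assume i: "i \<in> S"
    have "real i - real (Min S) \<le> R" using spread[OF i Min_in[OF assms(1) False]] .
    moreover have "Min S \<le> i" using assms(1) i by simp
    ultimately have "int (i - Min S) \<le> \<lfloor>R\<rfloor>" by (simp add: le_floor_iff of_nat_diff)
    then show "i \<in> {Min S..Min S + nat \<lfloor>R\<rfloor>}" using \<open>Min S \<le> i\<close> by simp
  qed
  then have "card S \<le> card {Min S..Min S + nat \<lfloor>R\<rfloor>}" by (intro card_mono) auto
  then have "real (card S) \<le> real (nat \<lfloor>R\<rfloor>) + 1" by simp
  moreover have "real (nat \<lfloor>R\<rfloor>) \<le> R" using assms(2) by simp
  ultimately show ?thesis by linarith
qed (use assms in simp)

text \<open>Every point of \<open>[0, L]\<close> has a digit sum at most \<open>L * l ^ n\<close>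
  below it, so about \<open>1 / (2 * w)\<close> of them can be selected, one for each odd multiple
  of \<open>L * w\<close>.\<close>

lemma well_spread_self:
  assumes l: "1 / 2 < l" "l < 1"
  shows "well_spread l l 1"
  unfolding well_spread_def
\<comment> \<open>An interval of radius \<open>r \<ge> w\<close> catches at most
  \<open>r / w + 3 / 2 \<le> 5 / 2 * (r / w)\<close> of the points, and
  \<open>N \<ge> 1 / (4 * w)\<close>; this gives 10.\<close>
proof (rule exI[of _ 10], rule allI)
  fix n0
  define L where "L = l / (1 - l)"
  have L: "1 < L" using l by (auto simp: L_def field_simps)
  have "(\<lambda>n. l ^ n) \<longlonglongrightarrow> 0" using l by (intro LIMSEQ_power_zero) auto
  from order_tendstoD(2)[OF this, of "1 / 4"]
  obtain n1 where n1: "\<And>n. n1 \<le> n \<Longrightarrow> l ^ n < 1 / 4" unfolding eventually_sequentially by auto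
  define n where "n = max n0 n1"
  define w where "w = l ^ n"
  have w: "0 < w" "w < 1 / 4" using n1[of n] l by (auto simp: w_def n_def)
  define N where "N = nat \<lfloor>1 / (2 * w)\<rfloor>"
  have N: "real N \<le> 1 / (2 * w)" "1 / (2 * w) < real N + 1" using w by (auto simp: N_def)
  have "1 \<le> 1 / (4 * w)" using w by (simp add: field_simps)
  moreover have "1 / (2 * w) = 1 / (4 * w) + 1 / (4 * w)" by simp
  ultimately have N4: "1 / (4 * w) \<le> real N" using N by linarith
  have "\<exists>s. s \<in> digit_sums l n \<and> s \<le> (2 * real i + 1) * (L * w) \<and> (2 * real i + 1) * (L * w) \<le> s + L * w"
    if "i < N" for i
  proof -
    have "(2 * real i + 1) * w \<le> 2 * real N * w" using that w by (intro mult_right_mono) auto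
    also have "\<dots> \<le> 1" using N w by (simp add: field_simps)
    finally have "L * ((2 * real i + 1) * w) \<le> L * 1" using L by (intro mult_left_mono) auto
    then have "(2 * real i + 1) * (L * w) \<le> L" by (simp add: mult_ac)
    then show ?thesis
      using digit_sums_dense[of l "(2 * real i + 1) * (L * w)" n] l L w
      by (auto simp: L_def[symmetric] w_def mult.commute)
  qed
  then obtain x where x: "\<And>i. i < N \<Longrightarrow> x i \<in> digit_sums l n"
    "\<And>i. i < N \<Longrightarrow> x i \<le> (2 * real i + 1) * (L * w)" "\<And>i. i < N \<Longrightarrow> (2 * real i + 1) * (L * w) \<le> x i + L * w"
    by metis
  have "real (card {i. i < N \<and> \<bar>x i - y\<bar> \<le> r}) \<le> 10 * r powr 1 * real N" if r: "w \<le> r" for y r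
  proof -
    have Lw: "0 < L * w" using L w by simp
    have "real (card {i. i < N \<and> \<bar>x i - y\<bar> \<le> r}) \<le> (r / (L * w) + 1 / 2) + 1"
    proof (rule card_le_spread)
      fix i j assume "i \<in> {i. i < N \<and> \<bar>x i - y\<bar> \<le> r}" "j \<in> {i. i < N \<and> \<bar>x i - y\<bar> \<le> r}"
      then have "(2 * real i + 1) * (L * w) - L * w - (2 * real j + 1) * (L * w) \<le> 2 * r"
        using x(3)[of i] x(2)[of j] by auto
      then have "(real i - real j) * (L * w) \<le> r + 1 / 2 * (L * w)" by (simp add: algebra_simps)
      then have "real i - real j \<le> (r + 1 / 2 * (L * w)) / (L * w)"
        using Lw by (simp only: pos_le_divide_eq)
      moreover have "(r + 1 / 2 * g) / g = r / g + 1 / 2" if "0 < g" for g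
        using that by (simp add: add_divide_distrib)
      ultimately show "real i - real j \<le> r / (L * w) + 1 / 2" using Lw by simp
    qed (use r w Lw in auto)
    also have "r / (L * w) \<le> r / w"
      using L w r by (intro divide_left_mono) auto
    also have "r / w + 1 / 2 + 1 \<le> 10 * r * (1 / (4 * w))" using r w by (simp add: field_simps)
    also have "\<dots> \<le> 10 * r * real N" using N4 r w by (intro mult_left_mono) auto
    finally show ?thesis using r w by simp
  qed
  moreover have "0 < N" using N4 w by (cases "N = 0") (auto simp: divide_le_0_iff)
  ultimately show "\<exists>n\<ge>n0. \<exists>N x. 0 < N \<and> (\<forall>i<N. x i \<in> digit_sums l n) \<and>
     (\<forall>y r. l ^ n \<le> r \<longrightarrow> real (card {i. i < N \<and> \<bar>x i - y\<bar> \<le> r}) \<le> 10 * r powr 1 * real N)"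
    using x(1) unfolding w_def by (intro exI[of _ n] exI[of _ N] exI[of _ x] conjI) (auto simp: n_def)
qed

text \<open>With \<open>\<theta> = l\<close> and \<open>\<sigma> = 1\<close> the smallness condition
  reads \<open>l * 2 powr (\<alpha> * t) < 1\<close>, which is the assumed bound on
  \<open>t\<close>.\<close>

lemma large_in_approx_open_self:
  assumes l: "1 / 2 < l" "l < 1" and \<alpha>: "1 < \<alpha>" and t: "0 < t" "t < - (ln l / ln 2) * (1 / \<alpha>)"
  shows "large_in t (approx_open l \<alpha> m)"
proof (rule large_in_approx_open[OF l, of \<alpha> l t 1])
  have "ln (1 / 2) < ln l" using l by (subst ln_less_cancel_iff) auto
  then have ln: "- ln l < ln 2" by (simp add: ln_div)
  have *: "\<alpha> * t * ln 2 < - ln l" using t(2) \<alpha> by (simp add: field_simps)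
  also have "\<dots> < 1 * ln 2" using ln by simp
  finally have "\<alpha> * t < 1" by (simp only: mult_less_cancel_right) auto
  moreover have "1 * t \<le> \<alpha> * t" using \<alpha> t by (intro mult_right_mono) auto
  ultimately show "t \<le> 1" by simp
  have "l powr 1 * 2 powr (\<alpha> * t) = exp (ln l + \<alpha> * t * ln 2)"
    using l by (simp add: powr_def exp_add)
  also have "\<dots> < exp 0" using * by (subst exp_less_cancel_iff) linarith
  finally show "l powr 1 * 2 powr (\<alpha> * t) < 1" by simp
qed (use l \<alpha> t well_spread_self in auto)

section \<open>Dimension drop from exact overlaps\<close>

lemma hausdorff_dim_W_set_less:
  assumes \<alpha>: "0 < \<alpha>" and m: "card (digit_sums l m) < 2 ^ m"
  shows "hausdorff_dim (W_set l \<alpha>) < ennreal (1 / \<alpha>)"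
proof -
  define c where "c = card (digit_sums l m)"
  have c: "1 \<le> c" "c < 2 ^ m" using m by (auto simp: c_def Suc_leI card_gt_0_iff)
  have m0: "0 < m" using c by (cases m) auto
  \<comment> \<open>Cardinalities are submultiplicative by \<open>digit_sums_add\<close>, so the
    deficit at level \<open>m\<close> persists: they are of order at most
    \<open>\<gamma> ^ n\<close> with \<open>\<gamma> < 2\<close>.\<close>
  define \<gamma> where "\<gamma> = real c powr (1 / m)"
  have \<gamma>: "1 \<le> \<gamma>" using c by (auto simp: \<gamma>_def intro!: ge_one_powr_ge_zero)
  have \<gamma>m: "\<gamma> ^ m = real c"
    using c m0 by (simp add: \<gamma>_def powr_realpow[symmetric] powr_powr)
  have \<gamma>2: "\<gamma> < 2"
  proof (rule power_less_imp_less_base)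
    show "\<gamma> ^ m < 2 ^ m" unfolding \<gamma>m using c(2) by (simp add: of_nat_less_numeral_power_cancel_iff)
  qed simp
  have mult: "card (digit_sums l (k + n)) \<le> card (digit_sums l k) * card (digit_sums l n)" for k n
  proof -
    have "digit_sums l (k + n) = (\<lambda>(s, s'). s + l ^ k * s') ` (digit_sums l k \<times> digit_sums l n)"
      unfolding digit_sums_add by auto
    then show ?thesis by (metis card_image_le finite_SigmaI finite_digit_sums card_cartesian_product)
  qed
  \<comment> \<open>The factor \<open>2 ^ m\<close> pays for the last block, of length below
    \<open>m\<close>.\<close>
  have card_le: "real (card (digit_sums l n)) \<le> 2 ^ m * \<gamma> ^ n" for n
  proof (induction n rule: less_induct)
    case (less n)
    show ?case
    proof (cases "n < m")
      case True
      have "real (card (digit_sums l n)) \<le> 2 ^ n"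
        using card_digit_sums_le[of l n] by (metis of_nat_le_iff of_nat_numeral of_nat_power)
      also have "\<dots> \<le> 2 ^ m * 1" using True by (simp add: power_increasing)
      also have "\<dots> \<le> 2 ^ m * \<gamma> ^ n" using \<gamma> by (intro mult_left_mono) (auto simp: one_le_power)
      finally show ?thesis .
    next
      case False
      then have "real (card (digit_sums l n)) \<le> real c * real (card (digit_sums l (n - m)))"
        using mult[of m "n - m"] by (simp add: c_def flip: of_nat_mult)
      also have "\<dots> \<le> real c * (2 ^ m * \<gamma> ^ (n - m))" using less[of "n - m"] False m0 by (intro mult_left_mono) auto
      also have "\<dots> = 2 ^ m * (\<gamma> ^ m * \<gamma> ^ (n - m))" by (simp add: \<gamma>m)
      also have "\<dots> = 2 ^ m * \<gamma> ^ n" using False by (simp flip: power_add)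
      finally show ?thesis .
    qed
  qed
  have "hausdorff_dim (W_set l \<alpha>) \<le> ennreal (ln \<gamma> / (\<alpha> * ln 2))"
    by (rule hausdorff_dim_W_set_le[OF \<alpha> \<gamma> card_le])
  also have "\<dots> < ennreal (1 / \<alpha>)"
  proof (rule ennreal_lessI)
    show "0 < 1 / \<alpha>" using \<alpha> by simp
    have "ln \<gamma> < ln 2" using \<gamma> \<gamma>2 by simp
    then show "ln \<gamma> / (\<alpha> * ln 2) < 1 / \<alpha>" using \<alpha> by (simp add: field_simps)
  qed
  finally show ?thesis .
qed

text \<open>If 1 is a digit sum, then \<open>l\<close> has an expansion with first digit 0 and one
  with first digit 1, so the two halves of the recursion overlap.\<close>

lemma card_digit_sums_less:
  assumes "l \<noteq> 0" and "1 \<in> digit_sums l n"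
  shows "card (digit_sums l (Suc n)) < 2 ^ Suc n"
proof -
  let ?A = "(\<lambda>x. l * x) ` digit_sums l n" and ?B = "(\<lambda>x. l * (1 + x)) ` digit_sums l n"
  have "0 \<in> digit_sums l n" by (induction n) auto
  then have "l * (1 + 0) \<in> ?B" by blast
  moreover have "l * 1 \<in> ?A" using assms(2) by blast
  ultimately have "?A \<inter> ?B \<noteq> {}" by auto
  then have "0 < card (?A \<inter> ?B)" by (simp add: card_gt_0_iff)
  moreover have "card (?A \<union> ?B) + card (?A \<inter> ?B) = card ?A + card ?B"
    using card_Un_Int[of ?A ?B] by simp
  moreover have "card ?A \<le> 2 ^ n" "card ?B \<le> 2 ^ n"
    using card_digit_sums_le[of l n] by (auto intro: order_trans[OF card_image_le])
  ultimately show ?thesis by simp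
qed


text \<open>Fix the digits of a good lower approximation of 1 at \<open>l0\<close>. Raising the
  parameter to \<open>l1\<close> multiplies their sum by at least \<open>l1 / l0\<close>, which
  takes it past 1; somewhere in between it equals 1.\<close>

lemma one_in_digit_sums_dense:
  assumes l0: "1 / 2 < l0" "l0 < 1" and e: "0 < e"
  shows "\<exists>l n. l0 \<le> l \<and> l < l0 + e \<and> l < 1 \<and> 1 \<in> digit_sums l n"
proof -
  define l1 where "l1 = (l0 + min 1 (l0 + e)) / 2"
  have l1: "l0 < l1" "l1 < 1" "l1 < l0 + e" using l0 e by (auto simp: l1_def min_def)
  define L where "L = l0 / (1 - l0)"
  have L: "1 < L" using l0 by (auto simp: L_def field_simps)
  have "(\<lambda>n. l0 ^ n * L) \<longlonglongrightarrow> 0 * L" using l0 by (intro tendsto_intros LIMSEQ_power_zero) auto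
  from order_tendstoD(2)[OF this, of "1 - l0 / l1"]
  have "\<forall>\<^sub>F n in sequentially. l0 ^ n * L < 1 - l0 / l1" using l1 l0 by simp
  then obtain n where n: "l0 ^ n * L < 1 - l0 / l1" unfolding eventually_sequentially by blast
  obtain s where s: "s \<in> digit_sums l0 n" "s \<le> 1" "1 \<le> s + l0 ^ n * L"
    using digit_sums_dense[of l0 1 n] l0 L by (auto simp: L_def)
  then obtain w where w: "w \<in> {1..n} \<rightarrow>\<^sub>E {0, 1}" "s = (\<Sum>i=1..n. w i * l0 ^ i)"
    unfolding digit_sums_eq_image by blast
  define F where "F l = (\<Sum>i=1..n. w i * l ^ i)" for l
  have w01: "w i = 0 \<or> w i = 1" if "i \<in> {1..n}" for i using w(1) that by (auto simp: PiE_def Pi_def)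
  have "l1 / l0 * F l0 \<le> F l1"
    unfolding F_def sum_distrib_left
  proof (rule sum_mono)
    fix i assume i: "i \<in> {1..n}"
    then obtain j where j: "i = Suc j" by (cases i) auto
    have "l1 / l0 * l0 ^ i = l1 * l0 ^ j" using l0 by (simp add: j)
    also have "\<dots> \<le> l1 * l1 ^ j" using l0 l1 by (intro mult_left_mono power_mono) auto
    finally have "l1 / l0 * l0 ^ i \<le> l1 ^ i" by (simp add: j)
    then show "l1 / l0 * (w i * l0 ^ i) \<le> w i * l1 ^ i" using w01[OF i] by auto
  qed
  moreover have "l1 / l0 * F l0 > l1 / l0 * (l0 / l1)"
    using s n w(2) l0 l1 by (intro mult_strict_left_mono) (auto simp: F_def)
  moreover have "l1 / l0 * (l0 / l1) = 1" using l0 l1 by simp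
  ultimately have "1 \<le> F l1" by linarith
  moreover have "F l0 \<le> 1" using s(2) w(2) by (simp add: F_def)
  moreover have "continuous_on {l0..l1} F" unfolding F_def by (intro continuous_intros)
  ultimately obtain l where l: "l0 \<le> l" "l \<le> l1" "F l = 1" using IVT'[of F l0 1 l1] l1 by auto
  have "F l \<in> digit_sums l n" unfolding F_def digit_sums_eq_image using w(1) by blast
  then show ?thesis using l l1 by (intro exI[of _ l] exI[of _ n]) auto
qed

section \<open>Counting digit sums for multinacci parameters\<close>

definition geo_sum :: "real \<Rightarrow> nat \<Rightarrow> real" where
  "geo_sum l n = (\<Sum>i<n. l ^ Suc i)"

lemma geo_sum_0 [simp]: "geo_sum l 0 = 0"
  by (simp add: geo_sum_def)

lemma geo_sum_Suc: "geo_sum l (Suc n) = geo_sum l n + l ^ Suc n"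
  by (simp add: geo_sum_def)

lemma geo_sum_add: "geo_sum l (m + n) = geo_sum l m + l ^ m * geo_sum l n"
  by (induction n) (auto simp: geo_sum_Suc algebra_simps power_add)

lemma geo_sum_Suc': "geo_sum l (Suc n) = l * (1 + geo_sum l n)"
  using geo_sum_add[of l 1 n] by (simp add: geo_sum_Suc algebra_simps)

lemma geo_sum_mono: "0 < l \<Longrightarrow> m \<le> n \<Longrightarrow> geo_sum l m \<le> geo_sum l n"
  unfolding geo_sum_def by (rule sum_mono2) auto

lemma geo_sum_in_digit_sums: "geo_sum l n \<in> digit_sums l n"
  by (induction n) (auto simp: geo_sum_Suc')

lemma zero_in_digit_sums: "0 \<in> digit_sums l n"
  by (induction n) auto

text \<open>
  \<open>run_free l d n x\<close>: the number \<open>x\<close> is the digit sum of a word of length \<open>n\<close> without \<open>d\<close> consecutive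
  ones. When \<open>geo_sum l d = 1\<close>, the word \<open>0 1\<^sup>d\<close> may be replaced by \<open>1 0\<^sup>d\<close>, so that only the words
  \<open>1\<^sup>n\<close> and \<open>1\<^sup>j 0 w\<close> with \<open>w\<close> free of such runs are needed.
\<close>

inductive run_free :: "real \<Rightarrow> nat \<Rightarrow> nat \<Rightarrow> real \<Rightarrow> bool" for l d where
  ones: "n < d \<Longrightarrow> run_free l d n (geo_sum l n)"
| block: "j < d \<Longrightarrow> run_free l d k x \<Longrightarrow> run_free l d (Suc (j + k)) (geo_sum l j + l ^ Suc j * x)"

lemma ones_zero_in_digit_sums:
  assumes "x \<in> digit_sums l k"
  shows "geo_sum l j + l ^ Suc j * x \<in> digit_sums l (Suc (j + k))"
proof -
  have "geo_sum l j \<in> digit_sums l (Suc j)"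
    unfolding digit_sums_Suc_last using geo_sum_in_digit_sums by blast
  then have "geo_sum l j + l ^ Suc j * x \<in> digit_sums l (Suc j + k)"
    unfolding digit_sums_add using assms by blast
  then show ?thesis by simp
qed

lemma run_free_in_digit_sums: "run_free l d n x \<Longrightarrow> x \<in> digit_sums l n"
  by (induction rule: run_free.induct) (rule geo_sum_in_digit_sums, rule ones_zero_in_digit_sums)

text \<open>Induction with a new first digit. Only a 0 put before a block of at least
  \<open>d\<close> ones leaves the normal form, and the carry repairs it.\<close>

lemma digit_sums_normal_form:
  assumes d: "0 < d" "geo_sum l d = 1" and "x \<in> digit_sums l n"
  shows "x = geo_sum l n \<or> (\<exists>j k y. n = Suc (j + k) \<and> run_free l d k y \<and> x = geo_sum l j + l ^ Suc j * y)"
    (is "?U n x")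
  using assms(3)
proof (induction n arbitrary: x)
  case (Suc n)
  have one: "?U (Suc n) (l * (1 + p))" if p: "p \<in> digit_sums l n" for p
    using Suc.IH[OF p]
  proof (elim disjE exE conjE)
    fix j k y assume "n = Suc (j + k)" "run_free l d k y" "p = geo_sum l j + l ^ Suc j * y"
    moreover from this have "l * (1 + p) = geo_sum l (Suc j) + l ^ Suc (Suc j) * y"
      by (simp add: geo_sum_Suc' algebra_simps)
    ultimately show ?thesis by (intro disjI2 exI[of _ "Suc j"] exI[of _ k] exI[of _ y]) auto
  qed (simp add: geo_sum_Suc')
  have zero: "?U (Suc n) (l * p)" if "run_free l d n p" for p
    using that by (intro disjI2 exI[of _ 0] exI[of _ n] exI[of _ p]) auto
  \<comment> \<open>As \<open>geo_sum l d = 1\<close>, the word \<open>0 1^d v\<close> has the sum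
    of \<open>1 0^d v\<close>, which falls under the case \<open>one\<close> at the same
    length.\<close>
  have carry: "?U (Suc n) (l * p)" if "p = geo_sum l d + l ^ d * q" "q \<in> digit_sums l (n - d)" "d \<le> n" for p q
  proof -
    have "0 + l ^ d * q \<in> digit_sums l (d + (n - d))"
      unfolding digit_sums_add using that(2) zero_in_digit_sums by blast
    then show ?thesis using one[of "l ^ d * q"] that d(2) by simp
  qed
  consider p where "p \<in> digit_sums l n" "x = l * p" | p where "p \<in> digit_sums l n" "x = l * (1 + p)"
    using Suc.prems by auto
  then show ?case
  proof cases
    case 1
    from Suc.IH[OF 1(1)] have "?U (Suc n) (l * p)"
    proof (elim disjE exE conjE)
      assume p: "p = geo_sum l n"
      show ?thesis
      proof (cases "n < d")
        case False
        then have "p = geo_sum l d + l ^ d * geo_sum l (n - d)"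
          using geo_sum_add[of l d "n - d"] by (simp add: p)
        then show ?thesis using carry geo_sum_in_digit_sums False by simp
      qed (use zero run_free.ones p in blast)
    next
      fix j k y assume *: "n = Suc (j + k)" "run_free l d k y" "p = geo_sum l j + l ^ Suc j * y"
      show ?thesis
      proof (cases "j < d")
        case False
        have "Suc j = d + Suc (j - d)" using False by simp
        then have "l ^ Suc j = l ^ d * l ^ Suc (j - d)" by (metis power_add)
        moreover have "geo_sum l j = geo_sum l d + l ^ d * geo_sum l (j - d)"
          using geo_sum_add[of l d "j - d"] False by simp
        ultimately have p: "p = geo_sum l d + l ^ d * (geo_sum l (j - d) + l ^ Suc (j - d) * y)"
          unfolding *(3) by (simp only: distrib_left mult.assoc add.assoc)
        have "geo_sum l (j - d) + l ^ Suc (j - d) * y \<in> digit_sums l (Suc ((j - d) + k))"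
          by (intro ones_zero_in_digit_sums run_free_in_digit_sums[OF *(2)])
        moreover have "Suc ((j - d) + k) = n - d" using * False by simp
        ultimately have "geo_sum l (j - d) + l ^ Suc (j - d) * y \<in> digit_sums l (n - d)" by metis
        then show ?thesis by (rule carry[OF p]) (use * False in simp)
      qed (use zero run_free.block * in blast)
    qed
    then show ?thesis using 1 by simp
  qed (use one in simp)
qed simp

lemma card_UN_affine_le:
  fixes B :: "nat \<Rightarrow> real set"
  assumes "finite J" and "\<And>j. j \<in> J \<Longrightarrow> finite (B j)" "\<And>j. j \<in> J \<Longrightarrow> real (card (B j)) \<le> b j"
  shows "real (card (\<Union>j\<in>J. f j ` B j)) \<le> (\<Sum>j\<in>J. b j)"
proof -
  have "card (\<Union>j\<in>J. f j ` B j) \<le> (\<Sum>j\<in>J. card (f j ` B j))" by (rule card_UN_le[OF assms(1)])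
  also have "\<dots> \<le> (\<Sum>j\<in>J. card (B j))" by (intro sum_mono card_image_le assms(2))
  finally have "real (card (\<Union>j\<in>J. f j ` B j)) \<le> (\<Sum>j\<in>J. real (card (B j)))"
    by (simp flip: of_nat_sum)
  also have "\<dots> \<le> (\<Sum>j\<in>J. b j)" by (intro sum_mono assms(3))
  finally show ?thesis .
qed

lemma finite_run_free: "finite {x. run_free l d n x}"
  by (rule finite_subset[OF _ finite_digit_sums[of l n]]) (auto intro: run_free_in_digit_sums)

text \<open>Splitting off the first block gives a linear recursion with characteristic equation
  \<open>geo_sum l d = 1\<close>, solved by \<open>(1 / l) ^ n\<close>.\<close>

lemma card_run_free_le:
  assumes l: "1 / 2 < l" and d: "geo_sum l d = 1"
  shows "real (card {x. run_free l d n x}) \<le> 2 * (1 / l) ^ n"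
proof (induction n rule: less_induct)
  case (less n)
  define J where "J = {..<min d n}"
  define A where "A = (\<Union>j\<in>J. (\<lambda>x. geo_sum l j + l ^ Suc j * x) ` {x. run_free l d (n - Suc j) x})"
  have "{x. run_free l d n x} \<subseteq> A \<union> (if n < d then {geo_sum l n} else {})"
  proof
    fix x assume "x \<in> {x. run_free l d n x}"
    then have "run_free l d n x" by simp
    then show "x \<in> A \<union> (if n < d then {geo_sum l n} else {})"
      by cases (force simp: A_def J_def)+
  qed
  moreover have "finite A" unfolding A_def J_def by (auto intro: finite_run_free)
  ultimately have "card {x. run_free l d n x} \<le> card (A \<union> (if n < d then {geo_sum l n} else {}))"
    by (intro card_mono) auto
  also have "\<dots> \<le> card A + (if n < d then 1 else 0)"
    using card_Un_le[of A "if n < d then {geo_sum l n} else {}"] by (auto split: if_splits)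
  finally have "real (card {x. run_free l d n x}) \<le> real (card A) + (if n < d then 1 else 0)"
    by (auto split: if_splits)
  also have "real (card A) \<le> (\<Sum>j\<in>J. 2 * (1 / l) ^ (n - Suc j))"
    unfolding A_def by (rule card_UN_affine_le) (auto simp: J_def finite_run_free intro!: less)
  also have "\<dots> = (\<Sum>j\<in>J. 2 * (1 / l) ^ n * l ^ Suc j)"
  proof (rule sum.cong)
    fix j assume "j \<in> J"
    then have "n = (n - Suc j) + Suc j" by (simp add: J_def)
    then have "(1 / l) ^ n = (1 / l) ^ (n - Suc j) * (1 / l) ^ Suc j" by (metis power_add)
    then show "2 * (1 / l) ^ (n - Suc j) = 2 * (1 / l) ^ n * l ^ Suc j"
      using l by (simp add: power_one_over)
  qed simp
  also have "\<dots> = 2 * (1 / l) ^ n * geo_sum l (min d n)"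
    by (simp add: geo_sum_def J_def sum_distrib_left)
  also have "\<dots> + (if n < d then 1 else 0) \<le> 2 * (1 / l) ^ n"
  proof (cases "n < d")
    case True
    \<comment> \<open>The factor 2 pays for the word of ones: the next power contributes
      \<open>2 * (1 / l) ^ n * l ^ Suc n = 2 * l\<close>, which exceeds 1.\<close>
    then have "geo_sum l n + l ^ Suc n \<le> 1"
      using geo_sum_mono[of l "Suc n" d] l d by (simp add: geo_sum_Suc)
    then have "2 * (1 / l) ^ n * (geo_sum l n + l ^ Suc n) \<le> 2 * (1 / l) ^ n * 1"
      using l by (intro mult_left_mono) auto
    moreover have "2 * (1 / l) ^ n * l ^ Suc n = 2 * l" using l by (simp add: power_one_over)
    ultimately have "2 * (1 / l) ^ n * geo_sum l n + 2 * l \<le> 2 * (1 / l) ^ n"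
      by (simp only: distrib_left mult_1_right)
    moreover have "min d n = n" using True by simp
    ultimately show ?thesis using True l by simp
  next
    case False
    then have "min d n = d" by simp
    then show ?thesis using d False by simp
  qed
  finally show ?case by simp
qed

text \<open>Apart from the word of ones, the position of the first zero and a run-free remainder
  determine the sum; the counts form a geometric series.\<close>

lemma card_digit_sums_multinacci_le:
  assumes l: "1 / 2 < l" "l < 1" and d: "0 < d" "geo_sum l d = 1"
  shows "real (card (digit_sums l n)) \<le> (1 + 2 / (1 / l - 1)) * (1 / l) ^ n"
proof -
  define A where "A = (\<Union>j\<in>{..<n}. (\<lambda>x. geo_sum l j + l ^ Suc j * x) ` {x. run_free l d (n - Suc j) x})"
  have "digit_sums l n \<subseteq> insert (geo_sum l n) A"
    using digit_sums_normal_form[OF d] unfolding A_def by fastforce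
  moreover have "finite A" unfolding A_def by (auto intro: finite_run_free)
  ultimately have "card (digit_sums l n) \<le> card (insert (geo_sum l n) A)" by (intro card_mono) auto
  also have "\<dots> \<le> Suc (card A)" by (rule card_insert_le_m1) auto
  finally have "real (card (digit_sums l n)) \<le> 1 + real (card A)" by simp
  also have "real (card A) \<le> (\<Sum>j<n. 2 * (1 / l) ^ (n - Suc j))"
    unfolding A_def by (intro card_UN_affine_le card_run_free_le l d finite_run_free) auto
  also have "\<dots> = 2 * (\<Sum>j<n. (1 / l) ^ j)"
    by (simp add: sum_distrib_left sum.nat_diff_reindex[of "\<lambda>j. 2 * (1 / l) ^ j"])
  also have "(\<Sum>j<n. (1 / l) ^ j) = ((1 / l) ^ n - 1) / (1 / l - 1)"
    using l by (intro geometric_sum) auto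
  also have "\<dots> \<le> (1 / l) ^ n / (1 / l - 1)" using l by (intro divide_right_mono) auto
  also have "1 + 2 * ((1 / l) ^ n / (1 / l - 1)) \<le> (1 + 2 / (1 / l - 1)) * (1 / l) ^ n"
  proof -
    have "1 \<le> (1 / l) ^ n" using l by (intro one_le_power) auto
    then show ?thesis by (simp add: distrib_right)
  qed
  finally show ?thesis by simp
qed

text \<open>The sum is below 1 at \<open>1 / 2\<close> and equals \<open>d\<close> at 1. For
  \<open>d = 2\<close> the parameter is the reciprocal of the golden ratio.\<close>

lemma multinacci_exists:
  assumes "2 \<le> d"
  shows "\<exists>l. 1 / 2 < l \<and> l < 1 \<and> geo_sum l d = 1"
proof -
  have half: "geo_sum (1 / 2) n = 1 - (1 / 2) ^ n" for n
    by (induction n) (auto simp: geo_sum_Suc)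
  have one: "geo_sum 1 n = real n" for n by (simp add: geo_sum_def)
  have "continuous_on {1 / 2..1} (\<lambda>l. geo_sum l d)" unfolding geo_sum_def by (intro continuous_intros)
  then obtain l where l: "1 / 2 \<le> l" "l \<le> 1" "geo_sum l d = 1"
    using IVT'[of "\<lambda>l. geo_sum l d" "1 / 2" 1 1] half one assms by auto
  moreover have "l \<noteq> 1 / 2"
  proof
    assume "l = 1 / 2"
    then have "(1 / 2 :: real) ^ d = 0" using l(3) half[of d] by (simp only:)
    then show False by simp
  qed
  moreover have "l \<noteq> 1" using one[of d] l(3) assms by auto
  ultimately show ?thesis by (intro exI[of _ l]) auto
qed

section \<open>Transversality of power series with coefficients -1, 0, 1\<close>

definition sgn_poly :: "real poly \<Rightarrow> bool" where
  "sgn_poly p \<longleftrightarrow> (\<forall>i. coeff p i \<in> {-1, 0, 1})"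

lemma sgn_poly_pCons: "sgn_poly (pCons a p) \<longleftrightarrow> a \<in> {-1, 0, 1} \<and> sgn_poly p"
  unfolding sgn_poly_def
  by (metis coeff_pCons_0 coeff_pCons_Suc not0_implies_Suc)

lemma poly_pderiv_pCons:
  "poly (pderiv (pCons a p)) x = poly p x + x * poly (pderiv p) x"
  by (simp add: pderiv_pCons)

lemma poly_pderiv2_pCons:
  "poly (pderiv (pderiv (pCons a p))) (x::real) = 2 * poly (pderiv p) x + x * poly (pderiv (pderiv p)) x"
  by (simp add: pderiv_pCons pderiv_add)

text \<open>Comparison with the geometric series and its first two derivatives, whose values
  \<open>A\<close>, \<open>A ^ 2\<close> and \<open>2 * A ^ 3\<close> are reproduced by the
  recursions for \<open>pCons\<close>.\<close>

lemma sgn_poly_bounds: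
  assumes "sgn_poly p" and x: "0 \<le> x" "x < 1"
  shows "\<bar>poly p x\<bar> \<le> 1 / (1 - x)"
    and "\<bar>poly (pderiv p) x\<bar> \<le> 1 / (1 - x) ^ 2"
    and "\<bar>poly (pderiv (pderiv p)) x\<bar> \<le> 2 / (1 - x) ^ 3"
proof -
  define A where "A = 1 / (1 - x)"
  have A: "A > 0" "x * A = A - 1" using x by (auto simp: A_def field_simps)
  have "\<bar>poly p x\<bar> \<le> A \<and> \<bar>poly (pderiv p) x\<bar> \<le> A ^ 2 \<and> \<bar>poly (pderiv (pderiv p)) x\<bar> \<le> 2 * A ^ 3"
    using assms(1)
  proof (induction p)
    case 0
    then show ?case using A by simp
  next
    case (pCons a p)
    then have a: "\<bar>a\<bar> \<le> 1" and p: "\<bar>poly p x\<bar> \<le> A" "\<bar>poly (pderiv p) x\<bar> \<le> A ^ 2"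
        "\<bar>poly (pderiv (pderiv p)) x\<bar> \<le> 2 * A ^ 3"
      by (auto simp: sgn_poly_pCons)
    have "\<bar>x * poly p x\<bar> \<le> x * A"
      using p x by (simp add: abs_mult mult_left_mono)
    then have "\<bar>poly (pCons a p) x\<bar> \<le> A"
      using a A(2) by simp
    moreover have "\<bar>x * poly (pderiv p) x\<bar> \<le> x * A ^ 2"
      using p x by (simp add: abs_mult mult_left_mono)
    moreover have "x * A ^ 2 = A ^ 2 - A"
    proof -
      have "x * A ^ 2 = A * (x * A)" by (simp add: power2_eq_square)
      then show ?thesis unfolding A(2) by (simp add: power2_eq_square algebra_simps)
    qed
    moreover have "\<bar>x * poly (pderiv (pderiv p)) x\<bar> \<le> x * (2 * A ^ 3)"
      using p x by (simp add: abs_mult mult_left_mono)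
    moreover have "x * (2 * A ^ 3) = 2 * A ^ 3 - 2 * A ^ 2"
    proof -
      have "x * (2 * A ^ 3) = 2 * A ^ 2 * (x * A)" by (simp add: power2_eq_square power3_eq_cube)
      then show ?thesis unfolding A(2) by (simp add: power2_eq_square power3_eq_cube algebra_simps)
    qed
    ultimately show ?case
      using p A(1) unfolding poly_pderiv_pCons poly_pderiv2_pCons by linarith
  qed
  then show "\<bar>poly p x\<bar> \<le> 1 / (1 - x)"
    and "\<bar>poly (pderiv p) x\<bar> \<le> 1 / (1 - x) ^ 2"
    and "\<bar>poly (pderiv (pderiv p)) x\<bar> \<le> 2 / (1 - x) ^ 3"
    by (auto simp: A_def power_one_over)
qed

text \<open>
  Interval arithmetic in units of \<open>1/100000\<close>, for \<open>x\<close> between \<open>p\<close> and \<open>q\<close>. If \<open>P = a + x Q\<close>, then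
  \<open>Q = (P - a) / x\<close> and \<open>Q' = (P' - Q) / x\<close>. Bounds for \<open>P\<close> and \<open>P'\<close> thus propagate to \<open>Q\<close> and
  \<open>Q'\<close>, expanding by the factor \<open>1 / x\<close>, until they violate the a priori bounds \<open>1 / (1 - x)\<close> and
  \<open>1 / (1 - x)\<^sup>2\<close>; this excludes all polynomials with the given leading digits.
\<close>

definition div_lo :: "int \<Rightarrow> int \<Rightarrow> int \<Rightarrow> int" where
  "div_lo p q n = (if n \<ge> 0 then n * 100000 div q else n * 100000 div p)"

primrec excluded :: "int \<Rightarrow> int \<Rightarrow> nat \<Rightarrow> int \<Rightarrow> int \<Rightarrow> int \<Rightarrow> int \<Rightarrow> int \<Rightarrow> bool" where
  "excluded p q 0 tlo thi mlo mhi a = False"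
| "excluded p q (Suc n) tlo thi mlo mhi a =
    (let tlo' = div_lo p q (tlo - a * 100000);
         thi' = - div_lo p q (a * 100000 - thi);
         mlo' = div_lo p q (mlo - thi');
         mhi' = - div_lo p q (tlo' - mhi);
         r = 100000 - q
     in tlo' * r > 100000 ^ 2 \<or> thi' * r < - (100000 ^ 2) \<or>
        mlo' * r ^ 2 > 100000 ^ 3 \<or> mhi' * r ^ 2 < - (100000 ^ 3) \<or>
        (excluded p q n tlo' thi' mlo' mhi' 1 \<and> excluded p q n tlo' thi' mlo' mhi' 0 \<and>
         excluded p q n tlo' thi' mlo' mhi' (-1)))"

text \<open>The sign of \<open>n\<close> decides which end of the cell minimises
  \<open>n / x\<close>; integer division rounds down, so the bound is safe. Upper bounds are
  obtained from it by negation.\<close>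

lemma div_lo_le:
  assumes "0 < p" "real_of_int p \<le> 100000 * x" "100000 * x \<le> real_of_int q" "real_of_int n \<le> y * x"
  shows "real_of_int (div_lo p q n) \<le> y"
proof -
  have x: "x > 0" using assms by (smt (verit) of_int_pos zero_less_mult_iff)
  have q: "0 < q" using assms by (smt (verit) of_int_pos of_int_le_iff)
  have "real_of_int n / x \<le> y" using assms x by (simp add: field_simps)
  moreover have "real_of_int (div_lo p q n) \<le> real_of_int n / x"
  proof (cases "n \<ge> 0")
    case True
    have "real_of_int (n * 100000 div q) \<le> real_of_int (n * 100000) / real_of_int q"
      by (rule real_of_int_div4)
    also have "\<dots> \<le> real_of_int n / x"
    proof -
      have "real_of_int n * (100000 * x) \<le> real_of_int n * q"
        using True assms by (intro mult_left_mono) auto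
      then show ?thesis using x q by (simp add: field_simps)
    qed
    finally show ?thesis using True by (simp add: div_lo_def)
  next
    case False
    have "real_of_int (n * 100000 div p) \<le> real_of_int (n * 100000) / real_of_int p"
      by (rule real_of_int_div4)
    also have "\<dots> \<le> real_of_int n / x"
    proof -
      have "real_of_int n * (100000 * x) \<le> real_of_int n * p"
        using False assms by (intro mult_left_mono_neg) auto
      then show ?thesis using x assms(1) by (simp add: field_simps)
    qed
    finally show ?thesis using False by (simp add: div_lo_def)
  qed
  ultimately show ?thesis by linarith
qed

text \<open>For an actual polynomial in the enclosure none of the four tests can succeed, so the
  search passes on to its next coefficient, which the induction hypothesis excludes.\<close>

lemma excluded_sound:
  assumes "excluded p q n tlo thi mlo mhi a"
    and pq: "0 < p" "q < 100000" "real_of_int p \<le> 100000 * x" "100000 * x \<le> real_of_int q"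
    and "sgn_poly P" "coeff P 0 = real_of_int a"
    and "real_of_int tlo \<le> 100000 * poly P x" "100000 * poly P x \<le> real_of_int thi"
    and "real_of_int mlo \<le> 100000 * poly (pderiv P) x" "100000 * poly (pderiv P) x \<le> real_of_int mhi"
  shows False
  using assms(1,6-)
proof (induction n arbitrary: P tlo thi mlo mhi a)
  case 0
  then show ?case by simp
next
  case (Suc n)
  note ex = Suc.prems(1) and prems = Suc.prems(2-)
  obtain b Q where P: "P = pCons b Q" by (cases P)
  have b: "b = real_of_int a" using prems P by simp
  have Q: "sgn_poly Q" using prems P by (simp add: sgn_poly_pCons)
  have x: "0 < x" "x < 1" using pq by linarith+
  define T M where "T = poly Q x" and "M = poly (pderiv Q) x"
  have PT: "poly P x = a + x * T" and PM: "poly (pderiv P) x = T + x * M"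
    by (simp_all add: P b T_def M_def pderiv_pCons)
  define tlo' where "tlo' = div_lo p q (tlo - a * 100000)"
  define thi' where "thi' = - div_lo p q (a * 100000 - thi)"
  define mlo' where "mlo' = div_lo p q (mlo - thi')"
  define mhi' where "mhi' = - div_lo p q (tlo' - mhi)"
  have 1: "real_of_int tlo' \<le> 100000 * T"
    unfolding tlo'_def using prems PT by (intro div_lo_le[OF pq(1,3,4)]) (auto simp: algebra_simps)
  have 2: "100000 * T \<le> real_of_int thi'"
  proof -
    have "real_of_int (div_lo p q (a * 100000 - thi)) \<le> - 100000 * T"
      using prems PT by (intro div_lo_le[OF pq(1,3,4)]) (auto simp: algebra_simps)
    then show ?thesis by (simp add: thi'_def)
  qed
  have 3: "real_of_int mlo' \<le> 100000 * M"
    unfolding mlo'_def using prems PM 2 by (intro div_lo_le[OF pq(1,3,4)]) (auto simp: algebra_simps)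
  have 4: "100000 * M \<le> real_of_int mhi'"
  proof -
    have "real_of_int (div_lo p q (tlo' - mhi)) \<le> - 100000 * M"
      using prems PM 1 by (intro div_lo_le[OF pq(1,3,4)]) (auto simp: algebra_simps)
    then show ?thesis by (simp add: mhi'_def)
  qed
  \<comment> \<open>\<open>r\<close> is a lower bound for \<open>1 - x\<close> in the chosen units;
    multiplying by it replaces division by \<open>1 - x\<close>.\<close>
  define r where "r = 100000 - q"
  have r: "real_of_int r > 0" "real_of_int r \<le> 100000 * (1 - x)" using pq by (auto simp: r_def)
  have r2: "real_of_int r ^ 2 \<le> (100000 * (1 - x)) ^ 2" using r by (intro power_mono) auto
  have T: "\<bar>T\<bar> * r \<le> 100000"
  proof -
    have "\<bar>T\<bar> * r \<le> (1 / (1 - x)) * (100000 * (1 - x))"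
      using sgn_poly_bounds(1)[OF Q, of x] x r by (intro mult_mono) (auto simp: T_def)
    also have "\<dots> = 100000" using x by (simp add: field_simps)
    finally show ?thesis .
  qed
  have M: "\<bar>M\<bar> * r ^ 2 \<le> 100000 ^ 2"
  proof -
    have "\<bar>M\<bar> * r ^ 2 \<le> (1 / (1 - x) ^ 2) * (100000 * (1 - x)) ^ 2"
      using sgn_poly_bounds(2)[OF Q, of x] x r2 by (intro mult_mono) (auto simp: M_def)
    also have "\<dots> = 100000 ^ 2" unfolding power_mult_distrib using x by (simp add: divide_simps)
    finally show ?thesis .
  qed
  have n1: "\<not> tlo' * r > 100000 ^ 2"
  proof
    assume "tlo' * r > 100000 ^ 2"
    then have "real_of_int (tlo' * r) > real_of_int (100000 ^ 2)" by (simp only: of_int_less_iff)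
    moreover have "real_of_int tlo' * r \<le> 100000 * T * r" using 1 r by (intro mult_right_mono) auto
    moreover have "T * r \<le> \<bar>T\<bar> * r" using r by (intro mult_right_mono) auto
    ultimately show False using T by simp
  qed
  have n2: "\<not> thi' * r < - (100000 ^ 2)"
  proof
    assume "thi' * r < - (100000 ^ 2)"
    then have "real_of_int (thi' * r) < real_of_int (- (100000 ^ 2))" by (simp only: of_int_less_iff)
    moreover have "real_of_int thi' * r \<ge> 100000 * T * r" using 2 r by (intro mult_right_mono) auto
    moreover have "- T * r \<le> \<bar>T\<bar> * r" using r by (intro mult_right_mono) auto
    ultimately show False using T by simp
  qed
  have n3: "\<not> mlo' * r ^ 2 > 100000 ^ 3"
  proof
    assume "mlo' * r ^ 2 > 100000 ^ 3"
    then have "real_of_int (mlo' * r ^ 2) > real_of_int (100000 ^ 3)" by (simp only: of_int_less_iff)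
    moreover have "real_of_int mlo' * r ^ 2 \<le> 100000 * M * r ^ 2" using 3 r by (intro mult_right_mono) auto
    moreover have "M * r ^ 2 \<le> \<bar>M\<bar> * r ^ 2" using r by (intro mult_right_mono) auto
    ultimately show False using M by simp
  qed
  have n4: "\<not> mhi' * r ^ 2 < - (100000 ^ 3)"
  proof
    assume "mhi' * r ^ 2 < - (100000 ^ 3)"
    then have "real_of_int (mhi' * r ^ 2) < real_of_int (- (100000 ^ 3))" by (simp only: of_int_less_iff)
    moreover have "real_of_int mhi' * r ^ 2 \<ge> 100000 * M * r ^ 2" using 4 r by (intro mult_right_mono) auto
    moreover have "- M * r ^ 2 \<le> \<bar>M\<bar> * r ^ 2" using r by (intro mult_right_mono) auto
    ultimately show False using M by simp
  qed
  have "excluded p q n tlo' thi' mlo' mhi' 1 \<and> excluded p q n tlo' thi' mlo' mhi' 0 \<and>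
         excluded p q n tlo' thi' mlo' mhi' (-1)"
    using ex n1 n2 n3 n4
    by (simp only: excluded.simps Let_def tlo'_def thi'_def mlo'_def mhi'_def r_def) blast
  moreover have "coeff Q 0 \<in> {-1, 0, 1}" using Q by (auto simp: sgn_poly_def)
  ultimately show ?case
    using Suc.IH[of tlo' thi' mlo' mhi' 1 Q] Suc.IH[of tlo' thi' mlo' mhi' 0 Q] Suc.IH[of tlo' thi' mlo' mhi' "-1" Q]
      Q 1 2 3 4 by (auto simp: T_def M_def)
qed

text \<open>
  The cells were found by bisecting \<open>[1/2, 2/3]\<close> until the search closes. They shrink towards \<open>2/3\<close>
  since double zeros do exist from about \<open>0.6685\<close> on.
\<close>

definition cells :: "(int \<times> int) list" where
  "cells = [(50000, 58333), (58333, 62500), (62500, 64583), (64583, 65104), (65104, 65625),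
     (65625, 65885), (65885, 66146), (66146, 66276), (66276, 66406), (66406, 66536), (66536, 66667)]"

text \<open>The enclosures by 10 stand for \<open>1 / 10000\<close> in these units, the final 1 is
  the constant coefficient, and 11 is a depth at which every branch has closed.\<close>

lemma cells_excluded: "list_all (\<lambda>(p, q). excluded p q 11 (-10) 10 (-10) 10 1) cells"
  by code_simp

lemma transversality:
  assumes "sgn_poly P" "coeff P 0 = 1" "x \<in> {1/2..2/3}" "\<bar>poly P x\<bar> \<le> 1/10000"
  shows "\<bar>poly (pderiv P) x\<bar> > 1/10000"
proof (rule ccontr)
  assume neg: "\<not> ?thesis"
  \<comment> \<open>The last cell ends at 66667, just above \<open>100000 * (2 / 3)\<close>.\<close>
  have "\<exists>(p, q) \<in> set cells. p \<le> 100000 * x \<and> 100000 * x \<le> q"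
    using assms(3) by (simp add: cells_def) argo
  then obtain p q where pq: "(p, q) \<in> set cells" "p \<le> 100000 * x" "100000 * x \<le> q" by auto
  then have "0 < p" "q < 100000" by (auto simp: cells_def)
  moreover have "excluded p q 11 (-10) 10 (-10) 10 1"
    using cells_excluded pq by (auto simp: list_all_iff)
  moreover have "-10 \<le> 100000 * poly P x" "100000 * poly P x \<le> 10"
      "-10 \<le> 100000 * poly (pderiv P) x" "100000 * poly (pderiv P) x \<le> 10"
    using assms(4) neg by linarith+
  ultimately show False
    using excluded_sound[of p q 11 "-10" 10 "-10" 10 1 x P] assms(1,2) pq by simp
qed

section \<open>Pair correlation for almost every parameter\<close>

lemma Icc_fmeasurable [simp]: "{a..b :: real} \<in> fmeasurable lborel"
  by (rule fmeasurableI) (auto simp: emeasure_lborel_Icc_eq)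

lemma measure_le_if_close:
  fixes E :: "real set"
  assumes "E \<in> sets lborel" "0 \<le> D" and close: "\<And>x y. x \<in> E \<Longrightarrow> y \<in> E \<Longrightarrow> \<bar>x - y\<bar> \<le> D"
  shows "measure lborel E \<le> 2 * D"
proof (cases "E = {}")
  case False
  then obtain x where x: "x \<in> E" by blast
  have "E \<subseteq> {x - D..x + D}"
  proof
    fix y assume "y \<in> E"
    then show "y \<in> {x - D..x + D}" using close[OF x, of y] by auto
  qed
  then have "measure lborel E \<le> measure lborel {x - D..x + D}"
    using assms(1) by (intro measure_mono_fmeasurable) auto
  then show ?thesis using assms(2) by simp
qed (use assms in simp)

lemma sets_poly_small:
  fixes p :: "real poly"
  shows "{x \<in> {a..b}. \<bar>poly p x\<bar> \<le> \<rho>} \<in> sets lborel"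
proof -
  have "{x \<in> {a..b}. \<bar>poly p x\<bar> \<le> \<rho>} = {a..b} \<inter> {x. \<bar>poly p x\<bar> \<le> \<rho>}" by auto
  moreover have "closed {x. \<bar>poly p x\<bar> \<le> \<rho>}" by (intro closed_Collect_le continuous_intros)
  ultimately show ?thesis by auto
qed

text \<open>
  The interval is cut into pieces on which \<open>P'\<close> varies by at most \<open>1/20000\<close>, using \<open>\<bar>P''\<bar> \<le> 54\<close>. By
  transversality \<open>P\<close> is then steep on every piece on which it is small somewhere.
\<close>

lemma sgn_poly_measure_small:
  assumes P: "sgn_poly P" "coeff P 0 = 1" and \<rho>: "0 \<le> \<rho>"
  shows "measure lborel {x \<in> {1 / 2..2 / 3}. \<bar>poly P x\<bar> \<le> \<rho>} \<le> 100000000000 * \<rho>"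
proof (cases "1 / 10000 \<le> \<rho>")
  case True
  \<comment> \<open>For such \<open>\<rho>\<close> the bound exceeds the length \<open>1 / 6\<close>
    of the whole interval.\<close>
  have "measure lborel {x \<in> {1 / 2..2 / 3}. \<bar>poly P x\<bar> \<le> \<rho>} \<le> measure lborel {1 / 2..2 / 3 :: real}"
    by (intro measure_mono_fmeasurable sets_poly_small) auto
  then show ?thesis using True by simp
next
  case False
  define M :: nat where "M = 1080000"
  define E where "E i = {x \<in> {real i / M..(real i + 1) / M}. \<bar>poly P x\<bar> \<le> \<rho>} \<inter> {1 / 2..2 / 3}" for i
  have E_sets: "E i \<in> sets lborel" for i
    unfolding E_def using sets_poly_small[of "real i / M" "(real i + 1) / M" P \<rho>] by auto
  have cover: "{x \<in> {1 / 2..2 / 3}. \<bar>poly P x\<bar> \<le> \<rho>} \<subseteq> (\<Union>i<M. E i)"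
  proof
    fix x assume x: "x \<in> {x \<in> {1 / 2..2 / 3}. \<bar>poly P x\<bar> \<le> \<rho>}"
    define i where "i = nat \<lfloor>x * M\<rfloor>"
    have i: "real i \<le> x * M" "x * M < real i + 1" using x by (auto simp: i_def M_def)
    have "x * real M < 1 * real M" using x by (intro mult_strict_right_mono) (auto simp: M_def)
    then have "i < M" using i by simp
    moreover have "x \<in> E i" using x i by (auto simp: E_def M_def field_simps)
    ultimately show "x \<in> (\<Union>i<M. E i)" by blast
  qed
  have "measure lborel (E i) \<le> 2 * (40000 * \<rho>)" for i
  proof (rule measure_le_if_close[OF E_sets])
    have lt: "y - x \<le> 40000 * \<rho>" if xy: "x \<in> E i" "y \<in> E i" "x < y" for x y
    proof -
      obtain z where z: "x < z" "z < y" "poly P y - poly P x = (y - x) * poly (pderiv P) z"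
        using poly_MVT[OF xy(3)] by blast
      obtain v where v: "x < v" "v < z" "poly (pderiv P) z - poly (pderiv P) x = (z - x) * poly (pderiv (pderiv P)) v"
        using poly_MVT[OF z(1)] by blast
      have "v \<in> {0..2 / 3}" using v z xy by (auto simp: E_def)
      then have "\<bar>poly (pderiv (pderiv P)) v\<bar> \<le> 2 / (1 - v) ^ 3" using sgn_poly_bounds(3)[OF P(1)] by auto
      also have "\<dots> \<le> 2 / (1 / 3) ^ 3"
        using \<open>v \<in> _\<close> by (intro divide_left_mono power_mono mult_pos_pos) auto
      finally have P2: "\<bar>poly (pderiv (pderiv P)) v\<bar> \<le> 54" by (simp add: power3_eq_cube)
      have "(real i + 1) / M = real i / M + 1 / M" by (simp add: add_divide_distrib)
      then have "z - x \<le> 1 / M" using xy z by (auto simp: E_def)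
      then have "\<bar>(z - x) * poly (pderiv (pderiv P)) v\<bar> \<le> 1 / M * 54"
        unfolding abs_mult using P2 z by (intro mult_mono) auto
      then have "\<bar>poly (pderiv P) z - poly (pderiv P) x\<bar> \<le> 1 / 20000"
        unfolding v(3) by (simp add: M_def)
      moreover have "1 / 10000 < \<bar>poly (pderiv P) x\<bar>"
        using transversality[OF P, of x] xy False by (auto simp: E_def)
      ultimately have "1 / 20000 \<le> \<bar>poly (pderiv P) z\<bar>" by linarith
      then have "(y - x) * (1 / 20000) \<le> \<bar>(y - x) * poly (pderiv P) z\<bar>"
        unfolding abs_mult using xy by (intro mult_mono) auto
      also have "\<dots> = \<bar>poly P y - poly P x\<bar>" by (simp add: z(3))
      also have "\<dots> \<le> 2 * \<rho>" using xy by (auto simp: E_def)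
      finally show ?thesis by simp
    qed
    show "\<bar>x - y\<bar> \<le> 40000 * \<rho>" if "x \<in> E i" "y \<in> E i" for x y
      using lt[of x y] lt[of y x] that \<rho> by (cases x y rule: linorder_cases) auto
  qed (use \<rho> in simp)
  then have "(\<Sum>i<M. measure lborel (E i)) \<le> (\<Sum>i<M. 2 * (40000 * \<rho>))" by (intro sum_mono)
  moreover have "measure lborel (\<Union>i<M. E i) \<le> (\<Sum>i<M. measure lborel (E i))"
    using E_sets by (intro measure_UNION_le) auto
  moreover have "measure lborel {x \<in> {1 / 2..2 / 3}. \<bar>poly P x\<bar> \<le> \<rho>} \<le> measure lborel (\<Union>i<M. E i)"
  proof (rule measure_mono_fmeasurable[OF cover sets_poly_small])
    have "E i \<in> fmeasurable lborel" for i
      by (rule fmeasurableI2[OF Icc_fmeasurable[of "1 / 2" "2 / 3"] _ E_sets]) (auto simp: E_def)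
    then show "(\<Union>i<M. E i) \<in> fmeasurable lborel" by (intro fmeasurable.finite_UN) auto
  qed
  \<comment> \<open>The pieces add up to \<open>M * 2 * 40000 = 86400000000\<close> times
    \<open>\<rho>\<close>, which the constant in the statement rounds up.\<close>
  ultimately show ?thesis using \<rho> by (simp add: M_def)
qed

text \<open>Words are kept as polynomials, with the first digit as constant coefficient, so that
  they stay distinct for every parameter; the digit sum is \<open>l * poly p l\<close>.\<close>

primrec digit_polys :: "nat \<Rightarrow> real poly set" where
  "digit_polys 0 = {0}"
| "digit_polys (Suc n) = pCons 0 ` digit_polys n \<union> pCons 1 ` digit_polys n"

lemma finite_digit_polys [simp]: "finite (digit_polys n)"
  by (induction n) auto

lemma sum_digit_polys_Suc:
  "(\<Sum>p\<in>digit_polys (Suc n). f p) = (\<Sum>p\<in>digit_polys n. f (pCons 0 p) + f (pCons 1 p))"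
proof -
  have "(\<Sum>p\<in>digit_polys (Suc n). f p) = sum f (pCons 0 ` digit_polys n) + sum f (pCons 1 ` digit_polys n)"
    unfolding digit_polys.simps by (intro sum.union_disjoint) auto
  moreover have "sum f (pCons c ` digit_polys n) = (\<Sum>p\<in>digit_polys n. f (pCons c p))" for c
    by (subst sum.reindex) (auto simp: inj_on_def)
  ultimately show ?thesis by (simp add: sum.distrib)
qed

lemma card_digit_polys: "card (digit_polys n) = 2 ^ n"
  using sum_digit_polys_Suc[of "\<lambda>_. 1::nat"] by (induction n) auto

lemma digit_polys_digit_sums: "p \<in> digit_polys n \<Longrightarrow> l * poly p l \<in> digit_sums l n"
  by (induction n arbitrary: p) auto

lemma sgn_poly_diff:
  assumes "p \<in> digit_polys n" "q \<in> digit_polys n"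
  shows "sgn_poly (p - q)"
  using assms
proof (induction n arbitrary: p q)
  case 0
  then show ?case by (simp add: sgn_poly_def)
next
  case (Suc n)
  then obtain c d p' q' where "p = pCons c p'" "q = pCons d q'" "c \<in> {0, 1}" "d \<in> {0, 1}"
    "p' \<in> digit_polys n" "q' \<in> digit_polys n" by auto
  then show ?case using Suc.IH[of p' q'] by (auto simp: sgn_poly_pCons)
qed

section \<open>Parameters at which two words have close digit sums\<close>

definition close_set :: "real \<Rightarrow> real poly \<Rightarrow> real \<Rightarrow> real set" where
  "close_set a p \<rho> = {l \<in> {a..2 / 3}. \<bar>l * poly p l\<bar> \<le> \<rho>}"

lemma close_set_eq: "close_set a p \<rho> = {l \<in> {a..2 / 3}. \<bar>poly (pCons 0 p) l\<bar> \<le> \<rho>}"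
  by (simp add: close_set_def)

lemma close_set_fmeasurable: "close_set a p \<rho> \<in> fmeasurable lborel"
proof (rule fmeasurableI2[of "{a..2 / 3}"])
  show "close_set a p \<rho> \<in> sets lborel" unfolding close_set_eq by (rule sets_poly_small)
qed (auto simp: close_set_def)

lemmas close_set_measurable = fmeasurableD[OF close_set_fmeasurable]

text \<open>A common first digit cancels; the distance of the remainders is larger by the factor
  \<open>1 / l\<close>, which is at most \<open>1 / a\<close>.\<close>

lemma measure_close_set_pCons_0:
  assumes a: "0 < a"
  shows "measure lborel (close_set a (pCons 0 p) \<rho>) \<le> measure lborel (close_set a p (\<rho> / a))"
proof (rule measure_mono_fmeasurable[OF _ close_set_measurable close_set_fmeasurable])
  show "close_set a (pCons 0 p) \<rho> \<subseteq> close_set a p (\<rho> / a)"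
  proof
    fix l assume l: "l \<in> close_set a (pCons 0 p) \<rho>"
    then have "a * \<bar>l * poly p l\<bar> \<le> l * \<bar>l * poly p l\<bar>" by (intro mult_right_mono) (auto simp: close_set_def)
    also have "\<dots> = \<bar>l * poly (pCons 0 p) l\<bar>" using l a by (simp add: close_set_def abs_mult)
    also have "\<dots> \<le> \<rho>" using l by (simp only: close_set_def mem_Collect_eq)
    finally have "\<bar>l * poly p l\<bar> \<le> \<rho> / a" using a by (simp add: field_simps)
    then show "l \<in> close_set a p (\<rho> / a)" using l by (simp add: close_set_def)
  qed
qed

text \<open>The case of words with different first digits, where transversality enters through
  \<open>sgn_poly_measure_small\<close>.\<close>

lemma measure_close_set_pCons_1:
  assumes a: "1 / 2 \<le> a" and p: "sgn_poly p" and \<rho>: "0 \<le> \<rho>"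
  shows "measure lborel (close_set a (pCons 1 p) \<rho>) \<le> 100000000000 * (\<rho> / a)"
proof -
  have "measure lborel (close_set a (pCons 1 p) \<rho>)
      \<le> measure lborel {x \<in> {1 / 2..2 / 3}. \<bar>poly (pCons 1 p) x\<bar> \<le> \<rho> / a}"
  proof (rule measure_mono_fmeasurable)
    show "close_set a (pCons 1 p) \<rho> \<subseteq> {x \<in> {1 / 2..2 / 3}. \<bar>poly (pCons 1 p) x\<bar> \<le> \<rho> / a}"
    proof
      fix l assume l: "l \<in> close_set a (pCons 1 p) \<rho>"
      then have "a * \<bar>poly (pCons 1 p) l\<bar> \<le> l * \<bar>poly (pCons 1 p) l\<bar>"
        by (intro mult_right_mono) (auto simp: close_set_def)
      also have "\<dots> = \<bar>l * poly (pCons 1 p) l\<bar>" using l a by (simp add: close_set_def abs_mult)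
      also have "\<dots> \<le> \<rho>" using l by (simp only: close_set_def mem_Collect_eq)
      finally have "\<bar>poly (pCons 1 p) l\<bar> \<le> \<rho> / a" using a by (simp add: pos_le_divide_eq mult.commute)
      then show "l \<in> {x \<in> {1 / 2..2 / 3}. \<bar>poly (pCons 1 p) x\<bar> \<le> \<rho> / a}"
        using l a by (simp add: close_set_def)
    qed
    show "{x \<in> {1 / 2..2 / 3}. \<bar>poly (pCons 1 p) x\<bar> \<le> \<rho> / a} \<in> fmeasurable lborel"
      by (rule fmeasurableI2[OF Icc_fmeasurable[of "1 / 2" "2 / 3"] _ sets_poly_small]) auto
  qed (rule close_set_measurable)
  also have "\<dots> \<le> 100000000000 * (\<rho> / a)"
    using a p \<rho> by (intro sgn_poly_measure_small) (auto simp: sgn_poly_pCons)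
  finally show ?thesis .
qed

lemma close_set_minus: "close_set a (- p) \<rho> = close_set a p \<rho>"
  by (simp add: close_set_def)

text \<open>Recursion over the first digits: half of the pairs share them and pass to
  \<open>\<rho> / a\<close>, the others are controlled by transversality. As
  \<open>a > 1 / 2\<close>, the bound reproduces itself; the term \<open>2 ^ n\<close> comes from
  equal words.\<close>

lemma pair_measure_le:
  assumes a: "1 / 2 < a" "a \<le> 2 / 3" and \<rho>: "0 \<le> \<rho>"
  shows "(\<Sum>p\<in>digit_polys n. \<Sum>q\<in>digit_polys n. measure lborel (close_set a (p - q) \<rho>))
    \<le> 4 ^ n * (100000000000 / (2 * a - 1)) * \<rho> + 2 ^ n"
  using \<rho>
proof (induction n arbitrary: \<rho>)
  case 0
  have "close_set a 0 \<rho> = {a..2 / 3}" using 0 by (auto simp: close_set_def)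
  then show ?case using a 0 by (simp add: add_increasing)
next
  case (Suc n)
  define K :: real where "K = 100000000000"
  \<comment> \<open>\<open>K2\<close> solves \<open>2 * K2 / a + 2 * K / a = 4 * K2\<close>, the
    identity that closes the induction.\<close>
  define K2 where "K2 = K / (2 * a - 1)"
  define \<mu> where "\<mu> p \<rho> = measure lborel (close_set a p \<rho>)" for p \<rho>
  have K2: "K = K2 * (2 * a - 1)" using a by (simp add: K2_def)
  have "(\<Sum>p\<in>digit_polys (Suc n). \<Sum>q\<in>digit_polys (Suc n). \<mu> (p - q) \<rho>) =
      (\<Sum>p\<in>digit_polys n. \<Sum>q\<in>digit_polys n. 2 * \<mu> (pCons 0 (p - q)) \<rho> +
        (\<mu> (pCons 1 (p - q)) \<rho> + \<mu> (pCons (-1) (p - q)) \<rho>))"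
    unfolding sum_digit_polys_Suc by (simp add: sum.distrib sum_distrib_left algebra_simps)
  also have "\<dots> \<le> (\<Sum>p\<in>digit_polys n. \<Sum>q\<in>digit_polys n. 2 * \<mu> (p - q) (\<rho> / a) + 2 * (K * (\<rho> / a)))"
  proof (intro sum_mono)
    fix p q assume pq: "p \<in> digit_polys n" "q \<in> digit_polys n"
    have 0: "\<mu> (pCons 0 (p - q)) \<rho> \<le> \<mu> (p - q) (\<rho> / a)"
      unfolding \<mu>_def using a by (intro measure_close_set_pCons_0) auto
    have 1: "\<mu> (pCons 1 (p - q)) \<rho> \<le> K * (\<rho> / a)"
      unfolding \<mu>_def K_def using a Suc.prems sgn_poly_diff[OF pq] by (intro measure_close_set_pCons_1) auto
    have 2: "\<mu> (pCons (-1) (p - q)) \<rho> \<le> K * (\<rho> / a)"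
    proof -
      have "\<mu> (pCons 1 (q - p)) \<rho> \<le> K * (\<rho> / a)"
        unfolding \<mu>_def K_def using a Suc.prems sgn_poly_diff[OF pq(2,1)] by (intro measure_close_set_pCons_1) auto
      moreover have "pCons (-1) (p - q) = - pCons 1 (q - p)" by simp
      ultimately show ?thesis unfolding \<mu>_def using close_set_minus by metis
    qed
    show "2 * \<mu> (pCons 0 (p - q)) \<rho> + (\<mu> (pCons 1 (p - q)) \<rho> + \<mu> (pCons (-1) (p - q)) \<rho>)
        \<le> 2 * \<mu> (p - q) (\<rho> / a) + 2 * (K * (\<rho> / a))"
      using 0 1 2 by linarith
  qed
  also have "\<dots> = 2 * (\<Sum>p\<in>digit_polys n. \<Sum>q\<in>digit_polys n. \<mu> (p - q) (\<rho> / a)) + 4 ^ n * (2 * (K * (\<rho> / a)))"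
    by (simp add: sum.distrib sum_distrib_left card_digit_polys flip: power_mult_distrib)
  also have "\<dots> \<le> 2 * (4 ^ n * K2 * (\<rho> / a) + 2 ^ n) + 4 ^ n * (2 * (K * (\<rho> / a)))"
    using Suc.IH[of "\<rho> / a"] Suc.prems a by (simp add: K2_def K_def \<mu>_def)
  also have "\<dots> = 4 ^ Suc n * K2 * \<rho> + 2 ^ Suc n"
    unfolding K2 using a by (simp add: field_simps)
  finally show ?case by (simp add: K2_def K_def \<mu>_def)
qed

text \<open>A dyadic form of the \<open>\<sigma>\<close>-energy of the distribution of the digit sum
  of a uniform random word, cut off at scale \<open>(1 / 2) ^ n\<close> and with equal words
  included.\<close>

definition pair_energy :: "real \<Rightarrow> real \<Rightarrow> nat \<Rightarrow> real \<Rightarrow> real" where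
  "pair_energy a \<sigma> n l = (\<Sum>j\<le>n. \<Sum>p\<in>digit_polys n. \<Sum>q\<in>digit_polys n.
     (2 powr \<sigma>) ^ j / 4 ^ n * indicator (close_set a (p - q) ((1 / 2) ^ j)) l)"

text \<open>Integrated over the parameter, the proportion of pairs within \<open>(1 / 2) ^ j\<close>
  is of order \<open>(1 / 2) ^ j\<close>, so the scales contribute a geometric series of ratio
  \<open>2 powr (\<sigma> - 1)\<close>.\<close>

lemma pair_energy_integral:
  assumes a: "1 / 2 < a" "a \<le> 2 / 3" and \<sigma>: "\<sigma> < 1"
  shows "(\<integral>\<^sup>+l. ennreal (pair_energy a \<sigma> n l) \<partial>lborel)
    \<le> ennreal ((100000000000 / (2 * a - 1) + 1) * (1 / (1 - 2 powr (\<sigma> - 1))))"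
proof -
  define K2 where "K2 = 100000000000 / (2 * a - 1)"
  have K2: "0 \<le> K2" using a by (simp add: K2_def)
  have ind: "integrable lborel (indicator (close_set a p \<rho>) :: real \<Rightarrow> real)" for p \<rho>
    using close_set_fmeasurable[of a p \<rho>] by (simp add: integrable_indicator_iff fmeasurable_def)
  have int: "integrable lborel (pair_energy a \<sigma> n)"
    unfolding pair_energy_def[abs_def] by (intro Bochner_Integration.integrable_sum integrable_mult_right ind)
  have "integral\<^sup>L lborel (pair_energy a \<sigma> n) = (\<Sum>j\<le>n. (2 powr \<sigma>) ^ j / 4 ^ n *
      (\<Sum>p\<in>digit_polys n. \<Sum>q\<in>digit_polys n. measure lborel (close_set a (p - q) ((1 / 2) ^ j))))"
    unfolding pair_energy_def[abs_def]
    by (simp add: Bochner_Integration.integral_sum integrable_mult_right ind Bochner_Integration.integrable_sum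
        sum_distrib_left)
  also have "\<dots> \<le> (\<Sum>j\<le>n. (K2 + 1) * (2 powr (\<sigma> - 1)) ^ j)"
  proof (rule sum_mono)
    fix j assume "j \<in> {..n}"
    then have "(2::real) ^ j \<le> 2 ^ n" by (intro power_increasing) auto
    have "(\<Sum>p\<in>digit_polys n. \<Sum>q\<in>digit_polys n. measure lborel (close_set a (p - q) ((1 / 2) ^ j)))
        \<le> 4 ^ n * K2 * (1 / 2) ^ j + 2 ^ n"
      using pair_measure_le[OF a, of "(1 / 2) ^ j" n] by (simp add: K2_def)
    \<comment> \<open>The cutoff \<open>j \<le> n\<close> absorbs the equal words: their proportion
      \<open>(1 / 2) ^ n\<close> is at most \<open>(1 / 2) ^ j\<close>.\<close>
    also have "(2::real) ^ n \<le> 4 ^ n * (1 / 2) ^ j"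
    proof -
      have "(2::real) ^ n * 2 ^ j \<le> 2 ^ n * 2 ^ n" using \<open>2 ^ j \<le> 2 ^ n\<close> by (intro mult_left_mono) auto
      also have "\<dots> = 4 ^ n" by (simp flip: power_mult_distrib)
      finally show ?thesis by (simp add: field_simps power_one_over)
    qed
    also have "4 ^ n * K2 * (1 / 2) ^ j + 4 ^ n * (1 / 2) ^ j = 4 ^ n * ((K2 + 1) * (1 / 2) ^ j)"
      by (simp add: algebra_simps)
    finally have "(2 powr \<sigma>) ^ j / 4 ^ n *
        (\<Sum>p\<in>digit_polys n. \<Sum>q\<in>digit_polys n. measure lborel (close_set a (p - q) ((1 / 2) ^ j)))
      \<le> (2 powr \<sigma>) ^ j / 4 ^ n * (4 ^ n * ((K2 + 1) * (1 / 2) ^ j))"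
      by (intro mult_left_mono) auto
    also have "\<dots> = (K2 + 1) * ((2 powr \<sigma>) ^ j * (1 / 2) ^ j)" by simp
    also have "(2 powr \<sigma>) ^ j * (1 / 2) ^ j = (2 powr (\<sigma> - 1)) ^ j"
      by (simp add: powr_diff flip: power_mult_distrib)
    finally show "(2 powr \<sigma>) ^ j / 4 ^ n *
        (\<Sum>p\<in>digit_polys n. \<Sum>q\<in>digit_polys n. measure lborel (close_set a (p - q) ((1 / 2) ^ j)))
      \<le> (K2 + 1) * (2 powr (\<sigma> - 1)) ^ j" .
  qed
  also have "\<dots> = (K2 + 1) * (\<Sum>j\<le>n. (2 powr (\<sigma> - 1)) ^ j)" by (simp add: sum_distrib_left)
  also have "\<dots> \<le> (K2 + 1) * (1 / (1 - 2 powr (\<sigma> - 1)))"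
  proof (rule mult_left_mono)
    have "2 powr (\<sigma> - 1) < 2 powr 0" using \<sigma> by (intro powr_less_mono) auto
    then have r: "2 powr (\<sigma> - 1) < 1" by simp
    have "(\<Sum>j\<le>n. (2 powr (\<sigma> - 1)) ^ j) \<le> (\<Sum>j. (2 powr (\<sigma> - 1)) ^ j)"
      using r by (intro sum_le_suminf summable_geometric) auto
    also have "\<dots> = 1 / (1 - 2 powr (\<sigma> - 1))" using r by (intro suminf_geometric) auto
    finally show "(\<Sum>j\<le>n. (2 powr (\<sigma> - 1)) ^ j) \<le> 1 / (1 - 2 powr (\<sigma> - 1))" .
  qed (use K2 in simp)
  finally have le: "integral\<^sup>L lborel (pair_energy a \<sigma> n) \<le> (K2 + 1) * (1 / (1 - 2 powr (\<sigma> - 1)))" .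
  have "(\<integral>\<^sup>+l. ennreal (pair_energy a \<sigma> n l) \<partial>lborel) = ennreal (integral\<^sup>L lborel (pair_energy a \<sigma> n))"
    by (intro nn_integral_eq_integral int AE_I2) (auto simp: pair_energy_def intro!: sum_nonneg)
  also have "\<dots> \<le> ennreal ((K2 + 1) * (1 / (1 - 2 powr (\<sigma> - 1))))" using le by (rule ennreal_leI)
  finally show ?thesis by (simp add: K2_def)
qed

text \<open>By Fatou's lemma the lower limit of the energies has finite integral, hence is finite
  almost everywhere, and this bounds the energy for infinitely many \<open>n\<close>.\<close>

lemma AE_pair_energy_bounded:
  assumes a: "1 / 2 < a" "a \<le> 2 / 3" and \<sigma>: "\<sigma> < 1"
  shows "AE l in lborel. \<exists>C>0. \<forall>n0. \<exists>n\<ge>n0. pair_energy a \<sigma> n l \<le> C"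
proof -
  define u where "u n l = ennreal (pair_energy a \<sigma> n l)" for n l
  have meas: "u n \<in> borel_measurable lborel" for n
  proof -
    have "indicator (close_set a p \<rho>) \<in> borel_measurable lborel" for p \<rho>
      using close_set_fmeasurable[of a p \<rho>] by (intro borel_measurable_indicator) (auto dest: fmeasurableD)
    then show ?thesis unfolding u_def pair_energy_def by measurable
  qed
  have "(\<integral>\<^sup>+l. liminf (\<lambda>n. u n l) \<partial>lborel) \<le> liminf (\<lambda>n. \<integral>\<^sup>+l. u n l \<partial>lborel)"
    by (rule nn_integral_liminf[OF meas])
  also have "\<dots> \<le> liminf (\<lambda>n::nat. ennreal ((100000000000 / (2 * a - 1) + 1) * (1 / (1 - 2 powr (\<sigma> - 1)))))"
    unfolding u_def using pair_energy_integral[OF a \<sigma>] by (intro Liminf_mono always_eventually allI)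
  also have "\<dots> < \<infinity>" by (simp add: Liminf_const)
  finally have "AE l in lborel. liminf (\<lambda>n. u n l) \<noteq> \<infinity>"
    using meas by (intro nn_integral_PInf_AE) auto
  then show ?thesis
  proof (rule eventually_mono)
    fix l assume "liminf (\<lambda>n. u n l) \<noteq> \<infinity>"
    then obtain c where c: "0 \<le> c" "liminf (\<lambda>n. u n l) = ennreal c"
      by (cases "liminf (\<lambda>n. u n l)" rule: ennreal_cases) auto
    have "\<exists>n\<ge>n0. pair_energy a \<sigma> n l \<le> c + 1" for n0
    proof (rule ccontr)
      assume "\<not> ?thesis"
      then have "\<forall>n\<ge>n0. ennreal (c + 1) \<le> u n l" by (auto simp: u_def intro!: ennreal_leI)
      then have "ennreal (c + 1) \<le> liminf (\<lambda>n. u n l)"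
        by (intro Liminf_bounded) (auto simp: eventually_sequentially)
      then show False using c by simp
    qed
    then show "\<exists>C>0. \<forall>n0. \<exists>n\<ge>n0. pair_energy a \<sigma> n l \<le> C" using c by (intro exI[of _ "c + 1"]) auto
  qed
qed

section \<open>The main theorem\<close>

text \<open>Words whose own energy is at most twice the average bound are kept. If an interval of
  radius \<open>r\<close> contains the sum of one of them, the others in it are
  \<open>2 * r\<close>-close to it, and its energy limits their number.\<close>

lemma well_spread_if_energy:
  assumes \<sigma>: "0 < \<sigma>" and l: "l \<in> {a..2 / 3}" and C: "0 < C"
    and energy: "\<And>n0. \<exists>n\<ge>n0. pair_energy a \<sigma> n l \<le> C"
  shows "well_spread l (1 / 2) \<sigma>"
  unfolding well_spread_def
proof (rule exI[of _ "(4 * C + 1) * 4 powr \<sigma>"], rule allI)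
  fix n0
  obtain n where n: "n0 \<le> n" "pair_energy a \<sigma> n l \<le> C" using energy by blast
  define B where "B = digit_polys n"
  define I where "I j p q = (indicator (close_set a (p - q) ((1 / 2) ^ j)) l :: real)" for j p q
  define D where "D p = (\<Sum>j\<le>n. \<Sum>q\<in>B. (2 powr \<sigma>) ^ j * I j p q)" for p
  have B: "finite B" "card B = 2 ^ n" by (auto simp: B_def card_digit_polys)
  have D0: "0 \<le> D p" for p unfolding D_def I_def by (intro sum_nonneg) auto
  have "pair_energy a \<sigma> n l = (\<Sum>j\<le>n. \<Sum>p\<in>B. \<Sum>q\<in>B. (2 powr \<sigma>) ^ j * I j p q) / 4 ^ n"
    by (simp only: pair_energy_def B_def I_def sum_divide_distrib times_divide_eq_left)
  also have "\<dots> = (\<Sum>p\<in>B. D p) / 4 ^ n" unfolding D_def by (subst sum.swap) simp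
  finally have sumD: "(\<Sum>p\<in>B. D p) \<le> C * 4 ^ n" using n(2) by (simp add: pos_divide_le_eq)
  \<comment> \<open>By Markov's inequality at most half of the words fall outside
    \<open>Q\<close>.\<close>
  define Q where "Q = {p \<in> B. D p \<le> 2 * C * 2 ^ n}"
  have Q: "finite Q" "Q \<subseteq> B" using B by (auto simp: Q_def)
  have cardQ: "2 ^ n \<le> 2 * real (card Q)"
  proof -
    have "real (card (B - Q)) * (2 * C * 2 ^ n) = (\<Sum>p\<in>B - Q. 2 * C * 2 ^ n)" by simp
    also have "\<dots> \<le> (\<Sum>p\<in>B - Q. D p)" by (intro sum_mono) (auto simp: Q_def)
    also have "\<dots> \<le> (\<Sum>p\<in>B. D p)" using B D0 by (intro sum_mono2) auto
    also have "\<dots> \<le> C * 4 ^ n" by (rule sumD)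
    also have "\<dots> = C * 2 ^ n * 2 ^ n" by (simp flip: power_mult_distrib)
    finally have "2 * real (card (B - Q)) * (C * 2 ^ n) \<le> 2 ^ n * (C * 2 ^ n)" by (simp add: mult_ac)
    then have "2 * real (card (B - Q)) \<le> 2 ^ n" using C by (simp only: mult_le_cancel_right) simp
    moreover have "card (B - Q) + card Q = 2 ^ n"
      using B Q card_mono[OF B(1) Q(2)] by (simp add: card_Diff_subset)
    then have "real (card (B - Q)) + real (card Q) = 2 ^ n"
      by (metis of_nat_add of_nat_numeral of_nat_power)
    ultimately show ?thesis by linarith
  qed
  define N where "N = card Q"
  have "0 < real (card Q)" using cardQ zero_less_power[of "2::real" n] by linarith
  then have N: "0 < N" by (simp add: N_def)
  obtain f where f: "bij_betw f {0..<N} Q" using ex_bij_betw_nat_finite[OF Q(1)] by (auto simp: N_def)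
  have fQ: "f i \<in> Q" if "i < N" for i using f that by (auto simp: bij_betw_def)
  define x where "x i = l * poly (f i) l" for i
  have "real (card {i. i < N \<and> \<bar>x i - y\<bar> \<le> r}) \<le> (4 * C + 1) * 4 powr \<sigma> * r powr \<sigma> * real N"
    if r: "(1 / 2) ^ n \<le> r" for y r
  proof -
    define S where "S = {i. i < N \<and> \<bar>x i - y\<bar> \<le> r}"
    have r0: "0 < r" using r zero_less_power[of "1 / 2 :: real" n] by linarith
    have "real (card S) \<le> (4 * C + 1) * (4 * r) powr \<sigma> * real N"
    proof (cases "1 < 2 * r")
      case True
      have "card S \<le> card {..<N}" by (intro card_mono) (auto simp: S_def)
      moreover have "1 \<le> (4 * r) powr \<sigma>" using True \<sigma> by (intro ge_one_powr_ge_zero) auto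
      then have "1 * 1 \<le> (4 * C + 1) * (4 * r) powr \<sigma>" using C by (intro mult_mono) auto
      then have "1 * real N \<le> (4 * C + 1) * (4 * r) powr \<sigma> * real N" by (intro mult_right_mono) auto
      ultimately show ?thesis by simp
    next
      case False
      define P where "P j \<longleftrightarrow> (1 / 2 :: real) ^ Suc j < 2 * r" for j
      obtain k where "(1 / 2 :: real) ^ k < 2 * r" using real_arch_pow_inv[of "2 * r" "1 / 2"] r0 by auto
      then have "P k" using r0 by (simp add: P_def)
      \<comment> \<open>The dyadic scale with
        \<open>(1 / 2) ^ Suc j < 2 * r \<le> (1 / 2) ^ j\<close>; since
        \<open>r \<ge> (1 / 2) ^ n\<close>, it satisfies \<open>j \<le> n\<close> and occurs in the
        energy.\<close>
      define j where "j = (LEAST j. P j)"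
      have Pj: "P j" unfolding j_def using \<open>P k\<close> by (rule LeastI)
      have j: "2 * r \<le> (1 / 2) ^ j"
      proof (cases j)
        case (Suc i)
        then have "\<not> P i" using not_less_Least[of i P] by (simp add: j_def)
        then show ?thesis using Suc by (simp add: P_def)
      qed (use False in simp)
      have "j \<le> n"
      proof (rule ccontr)
        assume "\<not> j \<le> n"
        then have "(1 / 2 :: real) ^ j \<le> (1 / 2) ^ n" by (intro power_decreasing) auto
        then show False using j r r0 by linarith
      qed
      show ?thesis
      proof (cases "S = {}")
        case S: False
        then obtain i where i: "i < N" "\<bar>x i - y\<bar> \<le> r" by (auto simp: S_def)
        have "(2 powr \<sigma>) ^ j * real (card S) \<le> D (f i)"
        proof -
          have "inj_on f S" using f by (rule inj_on_subset[OF bij_betw_imp_inj_on]) (auto simp: S_def)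
          then have "real (card S) = (\<Sum>q\<in>f ` S. 1)" by (simp add: card_image)
          also have "\<dots> \<le> (\<Sum>q\<in>f ` S. I j (f i) q)"
          proof (rule sum_mono)
            fix q assume "q \<in> f ` S"
            then obtain i' where i': "q = f i'" "i' < N" "\<bar>x i' - y\<bar> \<le> r" by (auto simp: S_def)
            have "\<bar>x i - x i'\<bar> \<le> (1 / 2) ^ j" using i i' j by linarith
            then have "l \<in> close_set a (f i - q) ((1 / 2) ^ j)"
              using l i' by (simp add: close_set_def x_def right_diff_distrib)
            then show "1 \<le> I j (f i) q" by (simp add: I_def)
          qed
          also have "\<dots> \<le> (\<Sum>q\<in>B. I j (f i) q)"
            using B Q fQ by (intro sum_mono2) (auto simp: I_def S_def)
          finally have "(2 powr \<sigma>) ^ j * real (card S) \<le> (\<Sum>q\<in>B. (2 powr \<sigma>) ^ j * I j (f i) q)"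
            by (simp add: sum_distrib_left[symmetric])
          also have "\<dots> \<le> D (f i)"
            unfolding D_def using \<open>j \<le> n\<close>
            by (intro member_le_sum[of j "{..n}" "\<lambda>j. \<Sum>q\<in>B. (2 powr \<sigma>) ^ j * I j (f i) q"])
              (auto simp: I_def intro!: sum_nonneg)
          finally show ?thesis .
        qed
        also have "\<dots> \<le> 2 * C * 2 ^ n" using fQ[OF i(1)] by (simp add: Q_def)
        also have "\<dots> \<le> 2 * C * (2 * real N)" using cardQ C by (intro mult_left_mono) (auto simp: N_def)
        finally have le: "(2 powr \<sigma>) ^ j * real (card S) \<le> 4 * C * real N" by simp
        have "(1 / 2) ^ j \<le> 4 * r" using Pj by (simp add: P_def)
        then have "((1 / 2) ^ j) powr \<sigma> \<le> (4 * r) powr \<sigma>" using \<sigma> by (intro powr_mono2) auto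
        moreover have "((1 / 2) ^ j) powr \<sigma> * (2 powr \<sigma>) ^ j = 1"
        proof -
          have "((1 / 2) ^ j) powr \<sigma> = ((1 / 2) powr \<sigma>) ^ j"
            by (simp add: powr_realpow[symmetric] powr_powr mult.commute)
          moreover have "(1 / 2) powr \<sigma> * 2 powr \<sigma> = 1" by (simp flip: powr_mult)
          ultimately show ?thesis by (metis power_mult_distrib power_one)
        qed
        ultimately have "1 * real (card S) \<le> (4 * r) powr \<sigma> * (2 powr \<sigma>) ^ j * real (card S)"
          by (intro mult_right_mono) (metis mult_right_mono zero_le_power powr_ge_zero, simp)
        also have "\<dots> \<le> (4 * r) powr \<sigma> * (4 * C * real N)"
          unfolding mult.assoc using le by (intro mult_left_mono) auto
        also have "\<dots> \<le> (4 * C + 1) * (4 * r) powr \<sigma> * real N" by (simp add: algebra_simps)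
        finally show ?thesis by simp
      qed (use C in simp)
    qed
    also have "(4 * r) powr \<sigma> = 4 powr \<sigma> * r powr \<sigma>" by (rule powr_mult)
    finally show ?thesis by (simp add: S_def mult.assoc)
  qed
  moreover have "x i \<in> digit_sums l n" if "i < N" for i
    using fQ[OF that] Q digit_polys_digit_sums[of "f i" n l] by (auto simp: x_def B_def)
  ultimately show "\<exists>n\<ge>n0. \<exists>N x. 0 < N \<and> (\<forall>i<N. x i \<in> digit_sums l n) \<and>
     (\<forall>y r. (1 / 2) ^ n \<le> r \<longrightarrow>
        real (card {i. i < N \<and> \<bar>x i - y\<bar> \<le> r}) \<le> (4 * C + 1) * 4 powr \<sigma> * r powr \<sigma> * real N)"
    using n(1) N by blast
qed

section \<open>Almost every parameter\<close>

lemma AE_well_spread: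
  assumes a: "1 / 2 < a" "a \<le> 2 / 3" and \<sigma>: "0 < \<sigma>" "\<sigma> < 1"
  shows "AE l in lborel. l \<in> {a..2 / 3} \<longrightarrow> well_spread l (1 / 2) \<sigma>"
  using AE_pair_energy_bounded[OF a \<sigma>(2)]
proof (rule eventually_mono)
  fix l assume "\<exists>C>0. \<forall>n0. \<exists>n\<ge>n0. pair_energy a \<sigma> n l \<le> C"
  then show "l \<in> {a..2 / 3} \<longrightarrow> well_spread l (1 / 2) \<sigma>"
    using well_spread_if_energy[OF \<sigma>(1)] by metis
qed

lemma AE_W_set_falconer:
  assumes \<alpha>: "1 < \<alpha>"
  shows "AE l in lebesgue. l \<in> {1 / 2<..<2 / 3} \<longrightarrow> W_set l \<alpha> \<in> falconer_class_on (1 / \<alpha>) (I_interval l)"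
proof -
  \<comment> \<open>Countably many ranges and exponents exhaust \<open>l > 1 / 2\<close> and
    \<open>\<sigma> < 1\<close>, so the exceptional null sets can be united; the shift by 6 gives
    \<open>a 0 = 2 / 3\<close>.\<close>
  define a where "a k = 1 / 2 + 1 / (real k + 6)" for k :: nat
  define \<sigma> where "\<sigma> m = 1 - 1 / (real m + 2)" for m :: nat
  have a: "1 / 2 < a k" "a k \<le> 2 / 3" for k
    by (auto simp: a_def field_simps)
  have \<sigma>: "0 < \<sigma> m" "\<sigma> m < 1" for m by (auto simp: \<sigma>_def field_simps)
  have "AE l in lborel. \<forall>k m. l \<in> {a k..2 / 3} \<longrightarrow> well_spread l (1 / 2) (\<sigma> m)"
    unfolding AE_all_countable using AE_well_spread[OF a \<sigma>] by blast
  then have "AE l in lborel. l \<in> {1 / 2<..<2 / 3} \<longrightarrow> W_set l \<alpha> \<in> falconer_class_on (1 / \<alpha>) (I_interval l)"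
  proof (rule eventually_mono, intro impI)
    fix l assume spread: "\<forall>k m. l \<in> {a k..2 / 3} \<longrightarrow> well_spread l (1 / 2) (\<sigma> m)"
      and l: "l \<in> {1 / 2<..<2 / 3}"
    obtain k where k: "1 / (l - 1 / 2) < real k" using reals_Archimedean2 by blast
    have "1 / (real k + 6) \<le> l - 1 / 2"
    proof -
      have "1 < real k * (l - 1 / 2)" using k l by (simp add: pos_divide_less_eq)
      also have "\<dots> \<le> (real k + 6) * (l - 1 / 2)" using l by (intro mult_right_mono) auto
      finally show ?thesis by (simp add: field_simps)
    qed
    then have lk: "l \<in> {a k..2 / 3}" using l by (auto simp: a_def)
    show "W_set l \<alpha> \<in> falconer_class_on (1 / \<alpha>) (I_interval l)"
    proof (rule W_set_in_falconer_class_on)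
      show "1 / 2 < l" "l < 1" using l by auto
      fix t :: real and n assume t: "0 < t" "t < 1 / \<alpha>"
      have at: "\<alpha> * t < 1" using t \<alpha> by (simp add: field_simps)
      obtain m where m: "1 / (1 - \<alpha> * t) < real m" using reals_Archimedean2 by blast
      have "1 / (real m + 2) < 1 - \<alpha> * t"
      proof -
        have "1 < real m * (1 - \<alpha> * t)" using m at by (simp add: pos_divide_less_eq)
        also have "\<dots> \<le> (real m + 2) * (1 - \<alpha> * t)" using at by (intro mult_right_mono) auto
        finally show ?thesis by (simp add: field_simps)
      qed
      then have \<sigma>t: "\<alpha> * t < \<sigma> m" by (simp add: \<sigma>_def)
      show "large_in t (approx_open l \<alpha> n)"
      proof (rule large_in_approx_open)
        have "1 * t \<le> \<alpha> * t" using \<alpha> t by (intro mult_right_mono) auto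
        then show "t \<le> \<sigma> m" using \<sigma>t by simp
        show "well_spread l (1 / 2) (\<sigma> m)" using spread lk by blast
        have "(1 / 2) powr \<sigma> m * 2 powr (\<alpha> * t) = 2 powr (\<alpha> * t - \<sigma> m)"
          by (simp add: powr_diff powr_divide)
        also have "\<dots> < 2 powr 0" using \<sigma>t by (intro powr_less_mono) auto
        finally show "(1 / 2) powr \<sigma> m * 2 powr (\<alpha> * t) < 1" by simp
      qed (use l \<alpha> t in auto)
    qed
  qed
  then show ?thesis by (rule AE_completion)
qed

section \<open>Exceptional parameters\<close>

lemma dense_dim_drop:
  assumes \<alpha>: "0 < \<alpha>"
  shows "\<exists>D \<subseteq> {1/2<..<1}. {1/2<..<1} \<subseteq> closure D \<and>
       (\<forall>l\<in>D. hausdorff_dim (W_set l \<alpha>) < ennreal (1 / \<alpha>))"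
proof (intro exI[of _ "{l \<in> {1/2<..<1}. \<exists>n. 1 \<in> digit_sums l n}"] conjI ballI)
  show "{1/2<..<1} \<subseteq> closure {l \<in> {1/2<..<1}. \<exists>n. 1 \<in> digit_sums l n}"
  proof
    fix l0 :: real assume l0: "l0 \<in> {1/2<..<1}"
    show "l0 \<in> closure {l \<in> {1/2<..<1}. \<exists>n. 1 \<in> digit_sums l n}"
      unfolding closure_approachable
    proof (intro allI impI)
      fix e :: real assume "0 < e"
      then obtain l n where l: "l0 \<le> l" "l < l0 + e" "l < 1" "1 \<in> digit_sums l n"
        using one_in_digit_sums_dense[of l0 e] l0 by auto
      then show "\<exists>y\<in>{l \<in> {1/2<..<1}. \<exists>n. 1 \<in> digit_sums l n}. dist y l0 < e"
        using l0 by (intro bexI[of _ l]) (auto simp: dist_real_def)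
    qed
  qed
next
  fix l assume "l \<in> {l \<in> {1/2<..<1}. \<exists>n. 1 \<in> digit_sums l n}"
  then obtain n where "l \<noteq> 0" "1 \<in> digit_sums l n" by auto
  then show "hausdorff_dim (W_set l \<alpha>) < ennreal (1 / \<alpha>)"
    by (intro hausdorff_dim_W_set_less[OF \<alpha> card_digit_sums_less])
qed auto

text \<open>One multinacci parameter is taken for each \<open>d \<ge> 2\<close>. The upper bound
  comes from the count of order \<open>(1 / l) ^ n\<close>, the lower bound is the one valid for
  every parameter.\<close>

lemma infinite_dim_eq:
  assumes \<alpha>: "1 < \<alpha>"
  shows "\<exists>C \<subseteq> {1/2<..<1}. countable C \<and> infinite C \<and>
       (\<forall>l\<in>C. hausdorff_dim (W_set l \<alpha>) = ennreal (- (ln l / ln 2) * (1 / \<alpha>)))"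
proof -
  obtain f where f: "\<And>d. 2 \<le> d \<Longrightarrow> 1 / 2 < f d \<and> f d < 1 \<and> geo_sum (f d) d = 1"
    using multinacci_exists by metis
  have "inj_on f {2..}"
  proof (rule linorder_inj_onI)
    fix d e :: nat assume de: "d < e" "d \<in> {2..}" "e \<in> {2..}"
    \<comment> \<open>The sum of \<open>d\<close> powers is already 1 at \<open>f d\<close>, so a
      longer sum exceeds 1 there and the parameters are distinct.\<close>
    have "geo_sum (f d) (Suc d) \<le> geo_sum (f d) e" using f[of d] de by (intro geo_sum_mono) auto
    moreover have "0 < f d ^ Suc d" using f[of d] de by (intro zero_less_power) auto
    moreover have "geo_sum (f d) d = 1" using f[of d] de by auto
    ultimately have "1 < geo_sum (f d) e" unfolding geo_sum_Suc by linarith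
    then show "f d \<noteq> f e" using f[of e] de by auto
  qed auto
  then have "infinite (f ` {2..})" by (simp add: finite_image_iff infinite_Ici)
  moreover have "hausdorff_dim (W_set l \<alpha>) = ennreal (- (ln l / ln 2) * (1 / \<alpha>))" if lf: "l \<in> f ` {2..}" for l
  proof (rule antisym)
    obtain d where d: "2 \<le> d" "l = f d" using lf by auto
    then have l: "1 / 2 < l" "l < 1" "geo_sum l d = 1" using f by auto
    have "hausdorff_dim (W_set l \<alpha>) \<le> ennreal (ln (1 / l) / (\<alpha> * ln 2))"
      by (rule hausdorff_dim_W_set_le[OF _ _ card_digit_sums_multinacci_le[OF l(1,2) _ l(3)]])
        (use \<alpha> l d in auto)
    also have "ln (1 / l) / (\<alpha> * ln 2) = - (ln l / ln 2) * (1 / \<alpha>)" using l by (simp add: ln_div)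
    finally show "hausdorff_dim (W_set l \<alpha>) \<le> ennreal (- (ln l / ln 2) * (1 / \<alpha>))" .
    show "ennreal (- (ln l / ln 2) * (1 / \<alpha>)) \<le> hausdorff_dim (W_set l \<alpha>)"
      by (rule hausdorff_dim_W_set_ge[OF l(1,2) large_in_approx_open_self[OF l(1,2) \<alpha>]])
  qed
  ultimately show ?thesis using f by (intro exI[of _ "f ` {2..}"]) auto
qed

theorem theorem1:
  fixes \<alpha> :: real
  assumes "1 < \<alpha>"
  shows "(\<forall>l\<in>{1/2<..<1}. hausdorff_dim (W_set l \<alpha>) \<le> ennreal (1 / \<alpha>)) \<and>
    (AE l in lebesgue. l \<in> {1/2<..<2/3} \<longrightarrow>
       W_set l \<alpha> \<in> falconer_class_on (1 / \<alpha>) (I_interval l)) \<and>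
    (\<exists>D \<subseteq> {1/2<..<1}. {1/2<..<1} \<subseteq> closure D \<and>
       (\<forall>l\<in>D. hausdorff_dim (W_set l \<alpha>) < ennreal (1 / \<alpha>))) \<and>
    (\<forall>l\<in>{1/2<..<1}.
       W_set l \<alpha> \<in> falconer_class_on (- (ln l / ln 2) * (1 / \<alpha>)) (I_interval l)) \<and>
    (\<exists>C \<subseteq> {1/2<..<1}. countable C \<and> infinite C \<and>
       (\<forall>l\<in>C. hausdorff_dim (W_set l \<alpha>) = ennreal (- (ln l / ln 2) * (1 / \<alpha>))))"
proof (intro conjI ballI)
  fix l :: real
  have "hausdorff_dim (W_set l \<alpha>) \<le> ennreal (ln 2 / (\<alpha> * ln 2))"
  \<comment> \<open>The trivial count of words, that is \<open>\<gamma> = 2\<close>.\<close>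
  proof (rule hausdorff_dim_W_set_le)
    show "real (card (digit_sums l n)) \<le> 1 * 2 ^ n" for n
      using card_digit_sums_le[of l n] by (metis mult_1 of_nat_le_iff of_nat_numeral of_nat_power)
  qed (use assms in auto)
  then show "hausdorff_dim (W_set l \<alpha>) \<le> ennreal (1 / \<alpha>)" by simp
next
  fix l :: real assume l: "l \<in> {1/2<..<1}"
  then show "W_set l \<alpha> \<in> falconer_class_on (- (ln l / ln 2) * (1 / \<alpha>)) (I_interval l)"
    using large_in_approx_open_self assms by (intro W_set_in_falconer_class_on) auto
qed (use assms AE_W_set_falconer dense_dim_drop infinite_dim_eq in auto)

end
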